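(* Let $\Gamma$ be a profinite group and let $(A\xrightarrow{\rho}G,\theta)$ be a crossed module of $\Gamma$-groups. (1) A class $[u,\psi]\in H^1(\Gamma,A\to G)$ lies in the image of $i_*\colon H^1(\Gamma,G)\to H^1(\Gamma,A\to G)$ if and only if $\Delta(u,\psi)_G\in H^2(\Gamma,A\ \mathrm{rel}\ G)$ is neutral. (2) There is an exact sequence $$H^1(\Gamma,A)\xrightarrow{\rho_*}H^1(\Gamma,G)\xrightarrow{i_*}H^1(\Gamma,A\to G)\xrightarrow{\Delta}H^2(\Gamma,A\ \mathrm{rel}\ G),$$ where exactness at $H^1(\Gamma,A\to G)$ means that the image of $i_*$ coincides with the preimage under $\Delta$ of the subset of neutral elements of $H^2(\Gamma,A\ \mathrm{rel}\ G)$.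
   Context: A crossed module of $\Gamma$-groups: (discrete) groups $A,G$ with $\Gamma$-actions by automorphisms, a $\Gamma$-equivariant homomorphism $\rho\colon A\to G$ and an action $\theta\colon G\to\mathrm{Aut}(A)$, ${}^ga=\theta_g(a)$, with ${}^{\rho(a)}a'=aa'a^{-1}$, $\rho({}^ga)=g\rho(a)g^{-1}$, ${}^\sigma({}^ga)={}^{{}^\sigma g}({}^\sigma a)$. $\mathrm{Maps}(-,-)$ denotes the set of locally constant maps from a profinite group to a group. $H^1(\Gamma,A\to G)$: $Z^1(\Gamma,A\to G)$ is the set of pairs $(u,\psi)\in\mathrm{Maps}(\Gamma\times\Gamma,A)\times\mathrm{Maps}(\Gamma,G)$ with $\rho(u_{\sigma,\tau})\psi_\sigma{}^\sigma\psi_\tau=\psi_{\sigma\tau}$ and $u_{\sigma,\tau\upsilon}\cdot{}^{\psi_\sigma}({}^\sigma u_{\tau,\upsilon})=u_{\sigma\tau,\upsilon}u_{\sigma,\tau}$. The group $\mathrm{Maps}(\Gamma,A)\times G$ with product $(\varphi^1,g_1)(\varphi^2,g_2)=(\varphi',g_1g_2)$, $\varphi'_\sigma={}^{g_1}\varphi^2_\sigma\varphi^1_\sigma$, acts on the right by $(u,\psi)*(\varphi,g)=(u',\psi')$, $u'_{\sigma,\tau}={}^{g^{-1}}\big(\varphi_{\sigma\tau}u_{\sigma,\tau}{}^{\psi_\sigma}({}^\sigma\varphi_\tau)^{-1}\varphi_\sigma^{-1}\big)$, $\psi'_\sigma=g^{-1}\rho(\varphi_\sigma)\psi_\sigma{}^\sigma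 g$; $H^1(\Gamma,A\to G)$ is the set of orbits, with base point $[1,1]$. The map $i_*$ is $[c]\mapsto[1,c]$, and $\rho_*$ is induced by $\rho$. Non-abelian $H^2$: a $\Gamma$-band is a locally constant homomorphism $\beta\colon\Gamma\to\mathrm{Out}(A)=\mathrm{Aut}(A)/\mathrm{Inn}(A)$. $Z^2(\Gamma,A,\beta)$ is the set of pairs $(u,f)$ with $u\in\mathrm{Maps}(\Gamma\times\Gamma,A)$ and $f\in\mathrm{Maps}(\Gamma,\mathrm{Aut}(A))$ such that $\mathrm{inn}(u_{\sigma,\tau})\circ f_\sigma\circ f_\tau=f_{\sigma\tau}$, $u_{\sigma,\tau\upsilon}f_\sigma(u_{\tau,\upsilon})=u_{\sigma\tau,\upsilon}u_{\sigma,\tau}$, and $f_\sigma\bmod\mathrm{Inn}(A)=\beta_\sigma$. $\mathrm{Maps}(\Gamma,A)$ acts on the left by $w*(u,f)=(u',f')$, $u'_{\sigma,\tau}=w_{\sigma\tau}u_{\sigma,\tau}f_\sigma(w_\tau)^{-1}w_\sigma^{-1}$, $f'_\sigma=\mathrm{inn}(w_\sigma)\circ f_\sigma$; $H^2(\Gamma,A,\beta)$ is the set of orbits $[u,f]$. A class is neutral if it is represented by some $(1,f)$. For $(u,\psi)\in Z^1(\Gamma,A\to G)$ put $f_\sigma=\theta_{\psi_\sigma}\circ\sigma\in\mathrm{Aut}(A)$ (where $\sigma$ denotes the action of $\sigma$ on $A$), and $\beta_\sigma=f_\sigma\bmod\mathrm{Inn}(A)$; then $\beta$ is a $\Gamma$-band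 and $(u,f)\in Z^2(\Gamma,A,\beta)$; set $\Delta(u,\psi)=[u,f]\in H^2(\Gamma,A,\beta)$. Let $\Phi$ be the set of all $\Gamma$-bands $\beta$ arising in this way. $G$ acts on the right on $\bigsqcup_{\beta\in\Phi}H^2(\Gamma,A,\beta)$ by $[u,f]\cdot g=[u',f']$, $u'_{\sigma,\tau}={}^{g^{-1}}u_{\sigma,\tau}$, $f'_\sigma=\theta_{g^{-1}}\circ f_\sigma\circ\theta_g$. Define $H^2(\Gamma,A\ \mathrm{rel}\ G)$ to be the set of $G$-orbits; $[u,f]_G$ denotes the orbit of $[u,f]$, and $\Delta(u,\psi)_G$ the orbit of $\Delta(u,\psi)$; an orbit is neutral if it contains a neutral element of $H^2(\Gamma,A,\beta)$ for some $\beta\in\Phi$. The map $\Delta\colon H^1(\Gamma,A\to G)\to H^2(\Gamma,A\ \mathrm{rel}\ G)$, $[u,\psi]\mapsto\Delta(u,\psi)_G$, is well defined. *)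

theory Defs
  imports "HOL-Analysis.Analysis" "HOL-Algebra.Bij" "HOL-Algebra.Coset"
begin

record 's top_group = "'s monoid" +
  gtop :: "'s topology"

locale profinite_group = group \<Gamma> for \<Gamma> :: "'s top_group" (structure) +
  assumes topspace_gtop: "topspace (gtop \<Gamma>) = carrier \<Gamma>"
    and continuous_mult:
      "continuous_map (prod_topology (gtop \<Gamma>) (gtop \<Gamma>)) (gtop \<Gamma>) (\<lambda>(\<sigma>, \<tau>). \<sigma> \<otimes> \<tau>)"
    and continuous_inv: "continuous_map (gtop \<Gamma>) (gtop \<Gamma>) (\<lambda>\<sigma>. inv \<sigma>)"
    and compact: "compact_space (gtop \<Gamma>)"
    and Hausdorff: "Hausdorff_space (gtop \<Gamma>)"
    and totally_disconnected:
      "\<And>\<sigma>. \<sigma> \<in> carrier \<Gamma> \<Longrightarrow> connected_component_of_set (gtop \<Gamma>) \<sigma> = {\<sigma>}"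

text \<open>
  Locally constant maps are continuous maps into a discrete space. All cochains are
  extensional, so that equality of cochains is equality on the (product of copies of the)
  carrier of \<open>\<Gamma>\<close>.
\<close>

definition Maps :: "'x topology \<Rightarrow> ('b, 'm) monoid_scheme \<Rightarrow> ('x \<Rightarrow> 'b) set" where
  "Maps X B = {f \<in> extensional (topspace X). continuous_map X (discrete_topology (carrier B)) f}"

text \<open>
  Maps \<open>f\<close> into a group \<open>B\<close> that are locally constant relative to a reference
  map \<open>r\<close>: the quotient \<open>f x \<cdot> (r x)\<^sup>-\<^sup>1\<close> is locally constant. If \<open>r\<close> is itself locally
  constant these are exactly the locally constant maps, see \<open>rel_Maps_eq_Maps\<close> below.
\<close>

definition rel_Maps ::
    "'x topology \<Rightarrow> ('b, 'm) monoid_scheme \<Rightarrow> ('x \<Rightarrow> 'b) \<Rightarrow> ('x \<Rightarrow> 'b) set" where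
  "rel_Maps X B r = {f \<in> topspace X \<rightarrow>\<^sub>E carrier B.
     continuous_map X (discrete_topology (carrier B)) (\<lambda>x. f x \<otimes>\<^bsub>B\<^esub> inv\<^bsub>B\<^esub> (r x))}"

lemma continuous_map_discrete_map2:
  assumes f: "continuous_map X (discrete_topology S) f"
    and g: "continuous_map X (discrete_topology T) g"
    and h: "\<And>s t. s \<in> S \<Longrightarrow> t \<in> T \<Longrightarrow> h s t \<in> U"
  shows "continuous_map X (discrete_topology U) (\<lambda>x. h (f x) (g x))"
proof -
  have "continuous_map X (prod_topology (discrete_topology S) (discrete_topology T))
      (\<lambda>x. (f x, g x))"
    using f g by (simp add: continuous_map_pairedI)
  then have "continuous_map X (discrete_topology (S \<times> T)) (\<lambda>x. (f x, g x))"
    by (simp add: prod_topology_discrete_topology)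
  moreover have "continuous_map (discrete_topology (S \<times> T)) (discrete_topology U)
      (\<lambda>(s, t). h s t)"
    using h by auto
  ultimately have "continuous_map X (discrete_topology U) ((\<lambda>(s, t). h s t) \<circ> (\<lambda>x. (f x, g x)))"
    by (rule continuous_map_compose)
  then show ?thesis by (simp add: o_def)
qed

lemma rel_Maps_eq_Maps:
  assumes "group B" and r: "continuous_map X (discrete_topology (carrier B)) r"
  shows "rel_Maps X B r = Maps X B"
proof -
  interpret group B by fact
  have rc: "r x \<in> carrier B" if "x \<in> topspace X" for x
    using continuous_map_funspace[OF r] that by auto
  show ?thesis
  proof (intro subset_antisym subsetI)
    fix f assume f: "f \<in> rel_Maps X B r"
    then have c: "continuous_map X (discrete_topology (carrier B)) (\<lambda>x. f x \<otimes>\<^bsub>B\<^esub> inv\<^bsub>B\<^esub> r x)"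
      and fc: "f \<in> topspace X \<rightarrow>\<^sub>E carrier B"
      by (auto simp: rel_Maps_def)
    have "continuous_map X (discrete_topology (carrier B)) (\<lambda>x. (f x \<otimes>\<^bsub>B\<^esub> inv\<^bsub>B\<^esub> r x) \<otimes>\<^bsub>B\<^esub> r x)"
      by (rule continuous_map_discrete_map2[OF c r]) auto
    moreover have "(f x \<otimes>\<^bsub>B\<^esub> inv\<^bsub>B\<^esub> r x) \<otimes>\<^bsub>B\<^esub> r x = f x" if "x \<in> topspace X" for x
      using PiE_mem[OF fc that] rc[OF that] by (simp add: m_assoc)
    ultimately have "continuous_map X (discrete_topology (carrier B)) f"
      by (rule continuous_map_eq)
    then show "f \<in> Maps X B" using fc by (auto simp: Maps_def PiE_def)
  next
    fix f assume "f \<in> Maps X B"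
    then have c: "continuous_map X (discrete_topology (carrier B)) f"
      and e: "f \<in> extensional (topspace X)" by (auto simp: Maps_def)
    have "continuous_map X (discrete_topology (carrier B)) (\<lambda>x. f x \<otimes>\<^bsub>B\<^esub> inv\<^bsub>B\<^esub> r x)"
      by (rule continuous_map_discrete_map2[OF c r]) auto
    with e continuous_map_funspace[OF c] show "f \<in> rel_Maps X B r"
      by (auto simp: rel_Maps_def PiE_def)
  qed
qed

record ('s, 'a) gamma_group = "'a monoid" +
  gact :: "'s \<Rightarrow> 'a \<Rightarrow> 'a"

definition is_gamma_group :: "'s top_group \<Rightarrow> ('s, 'a) gamma_group \<Rightarrow> bool" where
  "is_gamma_group \<Gamma> A \<longleftrightarrow>
     group A \<and>
     gact A \<in> hom \<Gamma> (AutoGroup A) \<and>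
     continuous_map (prod_topology (gtop \<Gamma>) (discrete_topology (carrier A)))
       (discrete_topology (carrier A)) (\<lambda>(\<sigma>, a). gact A \<sigma> a)"

locale crossed_module =
  fixes \<Gamma> :: "'s top_group" and A :: "('s, 'a) gamma_group" and G :: "('s, 'g) gamma_group"
    and \<rho> :: "'a \<Rightarrow> 'g" and \<theta> :: "'g \<Rightarrow> 'a \<Rightarrow> 'a"
  assumes gamma_A: "is_gamma_group \<Gamma> A"
    and gamma_G: "is_gamma_group \<Gamma> G"
    and rho_hom: "\<rho> \<in> hom A G"
    and theta_hom: "\<theta> \<in> hom G (AutoGroup A)"
    and rho_equivariant:
      "\<And>\<sigma> a. \<sigma> \<in> carrier \<Gamma> \<Longrightarrow> a \<in> carrier A \<Longrightarrow> \<rho> (gact A \<sigma> a) = gact G \<sigma> (\<rho> a)"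
    and peiffer:
      "\<And>a a'. a \<in> carrier A \<Longrightarrow> a' \<in> carrier A \<Longrightarrow>
         \<theta> (\<rho> a) a' = a \<otimes>\<^bsub>A\<^esub> a' \<otimes>\<^bsub>A\<^esub> inv\<^bsub>A\<^esub> a"
    and rho_theta:
      "\<And>g a. g \<in> carrier G \<Longrightarrow> a \<in> carrier A \<Longrightarrow>
         \<rho> (\<theta> g a) = g \<otimes>\<^bsub>G\<^esub> \<rho> a \<otimes>\<^bsub>G\<^esub> inv\<^bsub>G\<^esub> g"
    and theta_equivariant:
      "\<And>\<sigma> g a. \<sigma> \<in> carrier \<Gamma> \<Longrightarrow> g \<in> carrier G \<Longrightarrow> a \<in> carrier A \<Longrightarrow>
         gact A \<sigma> (\<theta> g a) = \<theta> (gact G \<sigma> g) (gact A \<sigma> a)"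

definition Z1 :: "'s top_group \<Rightarrow> ('s, 'a) gamma_group \<Rightarrow> ('s \<Rightarrow> 'a) set" where
  "Z1 \<Gamma> A = {c \<in> Maps (gtop \<Gamma>) A.
     \<forall>\<sigma>\<in>carrier \<Gamma>. \<forall>\<tau>\<in>carrier \<Gamma>. c (\<sigma> \<otimes>\<^bsub>\<Gamma>\<^esub> \<tau>) = c \<sigma> \<otimes>\<^bsub>A\<^esub> gact A \<sigma> (c \<tau>)}"

definition H1_class :: "'s top_group \<Rightarrow> ('s, 'a) gamma_group \<Rightarrow> ('s \<Rightarrow> 'a) \<Rightarrow> ('s \<Rightarrow> 'a) set" where
  "H1_class \<Gamma> A c = (\<lambda>a. \<lambda>\<sigma>\<in>carrier \<Gamma>. inv\<^bsub>A\<^esub> a \<otimes>\<^bsub>A\<^esub> c \<sigma> \<otimes>\<^bsub>A\<^esub> gact A \<sigma> a) ` carrier A"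

definition H1 :: "'s top_group \<Rightarrow> ('s, 'a) gamma_group \<Rightarrow> ('s \<Rightarrow> 'a) set set" where
  "H1 \<Gamma> A = H1_class \<Gamma> A ` Z1 \<Gamma> A"

definition Z1_cm ::
    "'s top_group \<Rightarrow> ('s, 'a) gamma_group \<Rightarrow> ('s, 'g) gamma_group \<Rightarrow> ('a \<Rightarrow> 'g) \<Rightarrow>
     ('g \<Rightarrow> 'a \<Rightarrow> 'a) \<Rightarrow> (('s \<times> 's \<Rightarrow> 'a) \<times> ('s \<Rightarrow> 'g)) set" where
  "Z1_cm \<Gamma> A G \<rho> \<theta> = {(u, \<psi>).
     u \<in> Maps (prod_topology (gtop \<Gamma>) (gtop \<Gamma>)) A \<and> \<psi> \<in> Maps (gtop \<Gamma>) G \<and>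
     (\<forall>\<sigma>\<in>carrier \<Gamma>. \<forall>\<tau>\<in>carrier \<Gamma>.
        \<rho> (u (\<sigma>, \<tau>)) \<otimes>\<^bsub>G\<^esub> \<psi> \<sigma> \<otimes>\<^bsub>G\<^esub> gact G \<sigma> (\<psi> \<tau>) = \<psi> (\<sigma> \<otimes>\<^bsub>\<Gamma>\<^esub> \<tau>)) \<and>
     (\<forall>\<sigma>\<in>carrier \<Gamma>. \<forall>\<tau>\<in>carrier \<Gamma>. \<forall>\<upsilon>\<in>carrier \<Gamma>.
        u (\<sigma>, \<tau> \<otimes>\<^bsub>\<Gamma>\<^esub> \<upsilon>) \<otimes>\<^bsub>A\<^esub> \<theta> (\<psi> \<sigma>) (gact A \<sigma> (u (\<tau>, \<upsilon>))) =
        u (\<sigma> \<otimes>\<^bsub>\<Gamma>\<^esub> \<tau>, \<upsilon>) \<otimes>\<^bsub>A\<^esub> u (\<sigma>, \<tau>))}"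

definition cm_act ::
    "'s top_group \<Rightarrow> ('s, 'a) gamma_group \<Rightarrow> ('s, 'g) gamma_group \<Rightarrow> ('a \<Rightarrow> 'g) \<Rightarrow>
     ('g \<Rightarrow> 'a \<Rightarrow> 'a) \<Rightarrow> ('s \<times> 's \<Rightarrow> 'a) \<times> ('s \<Rightarrow> 'g) \<Rightarrow> ('s \<Rightarrow> 'a) \<times> 'g \<Rightarrow>
     ('s \<times> 's \<Rightarrow> 'a) \<times> ('s \<Rightarrow> 'g)" where
  "cm_act \<Gamma> A G \<rho> \<theta> = (\<lambda>(u, \<psi>) (\<phi>, g).
     (\<lambda>(\<sigma>, \<tau>)\<in>carrier \<Gamma> \<times> carrier \<Gamma>.
        \<theta> (inv\<^bsub>G\<^esub> g) (\<phi> (\<sigma> \<otimes>\<^bsub>\<Gamma>\<^esub> \<tau>) \<otimes>\<^bsub>A\<^esub> u (\<sigma>, \<tau>) \<otimes>\<^bsub>A\<^esub>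
          inv\<^bsub>A\<^esub> (\<theta> (\<psi> \<sigma>) (gact A \<sigma> (\<phi> \<tau>))) \<otimes>\<^bsub>A\<^esub> inv\<^bsub>A\<^esub> (\<phi> \<sigma>)),
      \<lambda>\<sigma>\<in>carrier \<Gamma>. inv\<^bsub>G\<^esub> g \<otimes>\<^bsub>G\<^esub> \<rho> (\<phi> \<sigma>) \<otimes>\<^bsub>G\<^esub> \<psi> \<sigma> \<otimes>\<^bsub>G\<^esub> gact G \<sigma> g))"

definition H1_cm_class ::
    "'s top_group \<Rightarrow> ('s, 'a) gamma_group \<Rightarrow> ('s, 'g) gamma_group \<Rightarrow> ('a \<Rightarrow> 'g) \<Rightarrow>
     ('g \<Rightarrow> 'a \<Rightarrow> 'a) \<Rightarrow> ('s \<times> 's \<Rightarrow> 'a) \<times> ('s \<Rightarrow> 'g) \<Rightarrow>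
     (('s \<times> 's \<Rightarrow> 'a) \<times> ('s \<Rightarrow> 'g)) set" where
  "H1_cm_class \<Gamma> A G \<rho> \<theta> z = cm_act \<Gamma> A G \<rho> \<theta> z ` (Maps (gtop \<Gamma>) A \<times> carrier G)"

definition H1_cm ::
    "'s top_group \<Rightarrow> ('s, 'a) gamma_group \<Rightarrow> ('s, 'g) gamma_group \<Rightarrow> ('a \<Rightarrow> 'g) \<Rightarrow>
     ('g \<Rightarrow> 'a \<Rightarrow> 'a) \<Rightarrow> (('s \<times> 's \<Rightarrow> 'a) \<times> ('s \<Rightarrow> 'g)) set set" where
  "H1_cm \<Gamma> A G \<rho> \<theta> = H1_cm_class \<Gamma> A G \<rho> \<theta> ` Z1_cm \<Gamma> A G \<rho> \<theta>"

abbreviation one2 :: "'s top_group \<Rightarrow> ('s, 'a) gamma_group \<Rightarrow> 's \<times> 's \<Rightarrow> 'a" where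
  "one2 \<Gamma> A \<equiv> \<lambda>_\<in>carrier \<Gamma> \<times> carrier \<Gamma>. \<one>\<^bsub>A\<^esub>"

definition H1_cm_base ::
    "'s top_group \<Rightarrow> ('s, 'a) gamma_group \<Rightarrow> ('s, 'g) gamma_group \<Rightarrow> ('a \<Rightarrow> 'g) \<Rightarrow>
     ('g \<Rightarrow> 'a \<Rightarrow> 'a) \<Rightarrow> (('s \<times> 's \<Rightarrow> 'a) \<times> ('s \<Rightarrow> 'g)) set" where
  "H1_cm_base \<Gamma> A G \<rho> \<theta> = H1_cm_class \<Gamma> A G \<rho> \<theta> (one2 \<Gamma> A, \<lambda>_\<in>carrier \<Gamma>. \<one>\<^bsub>G\<^esub>)"

definition inn :: "('a, 'm) monoid_scheme \<Rightarrow> 'a \<Rightarrow> 'a \<Rightarrow> 'a" where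
  "inn A a = (\<lambda>x\<in>carrier A. a \<otimes>\<^bsub>A\<^esub> x \<otimes>\<^bsub>A\<^esub> inv\<^bsub>A\<^esub> a)"

definition Inn :: "('a, 'm) monoid_scheme \<Rightarrow> ('a \<Rightarrow> 'a) set" where
  "Inn A = inn A ` carrier A"

definition Out :: "('a, 'm) monoid_scheme \<Rightarrow> ('a \<Rightarrow> 'a) set monoid" where
  "Out A = AutoGroup A Mod Inn A"

definition mod_Inn :: "('a, 'm) monoid_scheme \<Rightarrow> ('a \<Rightarrow> 'a) \<Rightarrow> ('a \<Rightarrow> 'a) set" where
  "mod_Inn A f = Inn A #>\<^bsub>AutoGroup A\<^esub> f"

text \<open>
  For a continuous action of \<open>\<Gamma>\<close> on an infinite discrete group \<open>A\<close>, the map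
  \<open>\<Gamma> \<rightarrow> Aut(A)\<close> given by the action need not be locally constant, and then neither is
  \<open>\<sigma> \<mapsto> \<theta>\<^bsub>\<psi> \<sigma>\<^esub> \<circ> \<sigma>\<close>. Local constancy of maps from \<open>\<Gamma>\<close> to \<open>Aut(A)\<close> and of bands is
  therefore measured relative to the action of \<open>\<Gamma>\<close> on \<open>A\<close>. If \<open>\<Gamma> \<rightarrow> Aut(A)\<close> is
  locally constant, this is local constancy in the usual sense: see the lemmas
  \<open>aut_cochains_eq_Maps\<close> and \<open>bands_eq_Maps\<close>.
\<close>

definition aut_cochains :: "'s top_group \<Rightarrow> ('s, 'a) gamma_group \<Rightarrow> ('s \<Rightarrow> 'a \<Rightarrow> 'a) set" where
  "aut_cochains \<Gamma> A = rel_Maps (gtop \<Gamma>) (AutoGroup A) (gact A)"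

definition bands :: "'s top_group \<Rightarrow> ('s, 'a) gamma_group \<Rightarrow> ('s \<Rightarrow> ('a \<Rightarrow> 'a) set) set" where
  "bands \<Gamma> A = hom \<Gamma> (Out A) \<inter> rel_Maps (gtop \<Gamma>) (Out A) (\<lambda>\<sigma>. mod_Inn A (gact A \<sigma>))"

lemma aut_cochains_eq_Maps:
  assumes "group A"
    and "continuous_map (gtop \<Gamma>) (discrete_topology (carrier (AutoGroup A))) (gact A)"
  shows "aut_cochains \<Gamma> A = Maps (gtop \<Gamma>) (AutoGroup A)"
  unfolding aut_cochains_def
  using group.AutoGroup[OF assms(1)] assms(2) by (rule rel_Maps_eq_Maps)

lemma carrier_AutoGroup: "carrier (AutoGroup A) = auto A"
  by (simp add: AutoGroup_def)

lemma mult_AutoGroup: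
  "f \<in> auto A \<Longrightarrow> g \<in> auto A \<Longrightarrow> f \<otimes>\<^bsub>AutoGroup A\<^esub> g = compose (carrier A) f g"
  by (simp add: AutoGroup_def BijGroup_def auto_def)

lemma auto_mult:
  "f \<in> auto A \<Longrightarrow> x \<in> carrier A \<Longrightarrow> y \<in> carrier A \<Longrightarrow> f (x \<otimes>\<^bsub>A\<^esub> y) = f x \<otimes>\<^bsub>A\<^esub> f y"
  and auto_closed: "f \<in> auto A \<Longrightarrow> x \<in> carrier A \<Longrightarrow> f x \<in> carrier A"
  by (auto simp: auto_def hom_def)

lemma auto_inv:
  assumes "group A" "f \<in> auto A" "x \<in> carrier A"
  shows "f (inv\<^bsub>A\<^esub> x) = inv\<^bsub>A\<^esub> (f x)"
  using assms by (intro group_hom.hom_inv) (auto simp: group_hom_def group_hom_axioms_def auto_def)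

lemma inn_mem_auto:
  assumes "group A" "a \<in> carrier A"
  shows "inn A a \<in> auto A"
proof -
  interpret group A by fact
  note a = assms(2)
  have inv_mult_left: "inv\<^bsub>A\<^esub> b \<otimes>\<^bsub>A\<^esub> (b \<otimes>\<^bsub>A\<^esub> x) = x" "b \<otimes>\<^bsub>A\<^esub> (inv\<^bsub>A\<^esub> b \<otimes>\<^bsub>A\<^esub> x) = x"
    if "b \<in> carrier A" "x \<in> carrier A" for b x
    using that by (simp_all flip: m_assoc)
  have hom: "inn A a \<in> hom A A"
    using a by (intro homI) (simp_all add: inn_def m_assoc inv_mult_left)
  have 1: "inv\<^bsub>A\<^esub> a \<otimes>\<^bsub>A\<^esub> (a \<otimes>\<^bsub>A\<^esub> x \<otimes>\<^bsub>A\<^esub> inv\<^bsub>A\<^esub> a) \<otimes>\<^bsub>A\<^esub> a = x" if "x \<in> carrier A" for x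
    using a that by (simp add: m_assoc inv_mult_left)
  have 2: "a \<otimes>\<^bsub>A\<^esub> (inv\<^bsub>A\<^esub> a \<otimes>\<^bsub>A\<^esub> x \<otimes>\<^bsub>A\<^esub> a) \<otimes>\<^bsub>A\<^esub> inv\<^bsub>A\<^esub> a = x" if "x \<in> carrier A" for x
    using a that by (simp add: m_assoc inv_mult_left)
  have "bij_betw (inn A a) (carrier A) (carrier A)"
    by (rule bij_betw_byWitness[where f' = "\<lambda>x. inv\<^bsub>A\<^esub> a \<otimes>\<^bsub>A\<^esub> x \<otimes>\<^bsub>A\<^esub> a"])
      (use a 1 2 in \<open>auto simp: inn_def\<close>)
  with hom show ?thesis by (auto simp: auto_def Bij_def inn_def)
qed

lemma auto_inn:
  assumes "group A" "f \<in> auto A" "a \<in> carrier A"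
  shows "f \<otimes>\<^bsub>AutoGroup A\<^esub> inn A a = inn A (f a) \<otimes>\<^bsub>AutoGroup A\<^esub> f"
proof -
  interpret group A by fact
  show ?thesis
    unfolding mult_AutoGroup[OF assms(2) inn_mem_auto[OF assms(1,3)]]
      mult_AutoGroup[OF inn_mem_auto[OF assms(1) auto_closed[OF assms(2,3)]] assms(2)]
    using assms by (auto simp: compose_def inn_def auto_closed auto_mult auto_inv)
qed

lemma normal_Inn:
  assumes "group A"
  shows "Inn A \<lhd> AutoGroup A"
proof -
  interpret A: group A by fact
  interpret Aut: group "AutoGroup A" by (rule A.AutoGroup)
  have mult: "inn A a \<otimes>\<^bsub>AutoGroup A\<^esub> inn A b = inn A (a \<otimes>\<^bsub>A\<^esub> b)"
    if "a \<in> carrier A" "b \<in> carrier A" for a b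
    unfolding mult_AutoGroup[OF inn_mem_auto[OF assms that(1)] inn_mem_auto[OF assms that(2)]]
    using that by (auto simp: compose_def inn_def A.m_assoc A.inv_mult_group)
  have hom: "group_hom A (AutoGroup A) (inn A)"
    by unfold_locales (use assms mult in \<open>auto simp: hom_def carrier_AutoGroup inn_mem_auto\<close>)
  have sub: "subgroup (Inn A) (AutoGroup A)"
    unfolding Inn_def by (rule group_hom.img_is_subgroup[OF hom])
  show ?thesis
  proof (rule Aut.normal_invI[OF sub])
    fix f h assume f: "f \<in> carrier (AutoGroup A)" and "h \<in> Inn A"
    then obtain a where a: "a \<in> carrier A" "h = inn A a" by (auto simp: Inn_def)
    have fa: "f \<in> auto A" using f by (simp add: carrier_AutoGroup)
    have "inn A (f a) \<in> carrier (AutoGroup A)"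
      using assms auto_closed[OF fa a(1)] by (simp add: carrier_AutoGroup inn_mem_auto)
    then have "f \<otimes>\<^bsub>AutoGroup A\<^esub> h \<otimes>\<^bsub>AutoGroup A\<^esub> inv\<^bsub>AutoGroup A\<^esub> f = inn A (f a)"
      unfolding a(2) auto_inn[OF assms fa a(1)] using f
      by (simp add: Aut.m_assoc)
    then show "f \<otimes>\<^bsub>AutoGroup A\<^esub> h \<otimes>\<^bsub>AutoGroup A\<^esub> inv\<^bsub>AutoGroup A\<^esub> f \<in> Inn A"
      using auto_closed[OF fa a(1)] by (auto simp: Inn_def)
  qed
qed

lemma bands_eq_Maps:
  assumes A: "group A"
    and c: "continuous_map (gtop \<Gamma>) (discrete_topology (carrier (AutoGroup A))) (gact A)"
  shows "bands \<Gamma> A = hom \<Gamma> (Out A) \<inter> Maps (gtop \<Gamma>) (Out A)"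
proof -
  have "group (Out A)"
    unfolding Out_def by (rule normal.factorgroup_is_group[OF normal_Inn[OF A]])
  moreover have "continuous_map (gtop \<Gamma>) (discrete_topology (carrier (Out A)))
      (\<lambda>\<sigma>. mod_Inn A (gact A \<sigma>))"
    by (rule continuous_map_discrete_map2[OF c c, where h = "\<lambda>x _. mod_Inn A x"])
      (auto simp: Out_def mod_Inn_def carrier_FactGroup)
  ultimately show ?thesis unfolding bands_def by (simp add: rel_Maps_eq_Maps)
qed

definition Z2 ::
    "'s top_group \<Rightarrow> ('s, 'a) gamma_group \<Rightarrow> ('s \<Rightarrow> ('a \<Rightarrow> 'a) set) \<Rightarrow>
     (('s \<times> 's \<Rightarrow> 'a) \<times> ('s \<Rightarrow> 'a \<Rightarrow> 'a)) set" where
  "Z2 \<Gamma> A \<beta> = {(u, f).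
     u \<in> Maps (prod_topology (gtop \<Gamma>) (gtop \<Gamma>)) A \<and> f \<in> aut_cochains \<Gamma> A \<and>
     (\<forall>\<sigma>\<in>carrier \<Gamma>. \<forall>\<tau>\<in>carrier \<Gamma>.
        inn A (u (\<sigma>, \<tau>)) \<otimes>\<^bsub>AutoGroup A\<^esub> f \<sigma> \<otimes>\<^bsub>AutoGroup A\<^esub> f \<tau> = f (\<sigma> \<otimes>\<^bsub>\<Gamma>\<^esub> \<tau>)) \<and>
     (\<forall>\<sigma>\<in>carrier \<Gamma>. \<forall>\<tau>\<in>carrier \<Gamma>. \<forall>\<upsilon>\<in>carrier \<Gamma>.
        u (\<sigma>, \<tau> \<otimes>\<^bsub>\<Gamma>\<^esub> \<upsilon>) \<otimes>\<^bsub>A\<^esub> f \<sigma> (u (\<tau>, \<upsilon>)) = u (\<sigma> \<otimes>\<^bsub>\<Gamma>\<^esub> \<tau>, \<upsilon>) \<otimes>\<^bsub>A\<^esub> u (\<sigma>, \<tau>)) \<and>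
     (\<forall>\<sigma>\<in>carrier \<Gamma>. mod_Inn A (f \<sigma>) = \<beta> \<sigma>)}"

definition Maps_act ::
    "'s top_group \<Rightarrow> ('s, 'a) gamma_group \<Rightarrow> ('s \<Rightarrow> 'a) \<Rightarrow>
     ('s \<times> 's \<Rightarrow> 'a) \<times> ('s \<Rightarrow> 'a \<Rightarrow> 'a) \<Rightarrow> ('s \<times> 's \<Rightarrow> 'a) \<times> ('s \<Rightarrow> 'a \<Rightarrow> 'a)" where
  "Maps_act \<Gamma> A w = (\<lambda>(u, f).
     (\<lambda>(\<sigma>, \<tau>)\<in>carrier \<Gamma> \<times> carrier \<Gamma>.
        w (\<sigma> \<otimes>\<^bsub>\<Gamma>\<^esub> \<tau>) \<otimes>\<^bsub>A\<^esub> u (\<sigma>, \<tau>) \<otimes>\<^bsub>A\<^esub> inv\<^bsub>A\<^esub> (f \<sigma> (w \<tau>)) \<otimes>\<^bsub>A\<^esub> inv\<^bsub>A\<^esub> (w \<sigma>),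
      \<lambda>\<sigma>\<in>carrier \<Gamma>. inn A (w \<sigma>) \<otimes>\<^bsub>AutoGroup A\<^esub> f \<sigma>))"

definition H2_class ::
    "'s top_group \<Rightarrow> ('s, 'a) gamma_group \<Rightarrow> ('s \<times> 's \<Rightarrow> 'a) \<times> ('s \<Rightarrow> 'a \<Rightarrow> 'a) \<Rightarrow>
     (('s \<times> 's \<Rightarrow> 'a) \<times> ('s \<Rightarrow> 'a \<Rightarrow> 'a)) set" where
  "H2_class \<Gamma> A z = (\<lambda>w. Maps_act \<Gamma> A w z) ` Maps (gtop \<Gamma>) A"

definition H2 ::
    "'s top_group \<Rightarrow> ('s, 'a) gamma_group \<Rightarrow> ('s \<Rightarrow> ('a \<Rightarrow> 'a) set) \<Rightarrow>
     (('s \<times> 's \<Rightarrow> 'a) \<times> ('s \<Rightarrow> 'a \<Rightarrow> 'a)) set set" where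
  "H2 \<Gamma> A \<beta> = H2_class \<Gamma> A ` Z2 \<Gamma> A \<beta>"

definition neutral_class ::
    "'s top_group \<Rightarrow> ('s, 'a) gamma_group \<Rightarrow>
     (('s \<times> 's \<Rightarrow> 'a) \<times> ('s \<Rightarrow> 'a \<Rightarrow> 'a)) set \<Rightarrow> bool" where
  "neutral_class \<Gamma> A x \<longleftrightarrow> (\<exists>f. (one2 \<Gamma> A, f) \<in> x)"

definition aut_part ::
    "'s top_group \<Rightarrow> ('s, 'a) gamma_group \<Rightarrow> ('g \<Rightarrow> 'a \<Rightarrow> 'a) \<Rightarrow> ('s \<Rightarrow> 'g) \<Rightarrow>
     ('s \<Rightarrow> 'a \<Rightarrow> 'a)" where
  "aut_part \<Gamma> A \<theta> \<psi> = (\<lambda>\<sigma>\<in>carrier \<Gamma>. \<theta> (\<psi> \<sigma>) \<otimes>\<^bsub>AutoGroup A\<^esub> gact A \<sigma>)"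

definition Phi ::
    "'s top_group \<Rightarrow> ('s, 'a) gamma_group \<Rightarrow> ('s, 'g) gamma_group \<Rightarrow> ('a \<Rightarrow> 'g) \<Rightarrow>
     ('g \<Rightarrow> 'a \<Rightarrow> 'a) \<Rightarrow> ('s \<Rightarrow> ('a \<Rightarrow> 'a) set) set" where
  "Phi \<Gamma> A G \<rho> \<theta> = {\<beta> \<in> bands \<Gamma> A.
     \<exists>(u, \<psi>)\<in>Z1_cm \<Gamma> A G \<rho> \<theta>. \<beta> = (\<lambda>\<sigma>\<in>carrier \<Gamma>. mod_Inn A (aut_part \<Gamma> A \<theta> \<psi> \<sigma>))}"

text \<open>
  A cocycle \<open>(u, f)\<close> determines its band, and the band is constant on classes, so the
  union of the sets \<open>H\<^sup>2(\<Gamma>, A, \<beta>)\<close> over \<open>\<beta> \<in> \<Phi>\<close> is automatically disjoint.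
\<close>

definition H2_Phi ::
    "'s top_group \<Rightarrow> ('s, 'a) gamma_group \<Rightarrow> ('s, 'g) gamma_group \<Rightarrow> ('a \<Rightarrow> 'g) \<Rightarrow>
     ('g \<Rightarrow> 'a \<Rightarrow> 'a) \<Rightarrow> (('s \<times> 's \<Rightarrow> 'a) \<times> ('s \<Rightarrow> 'a \<Rightarrow> 'a)) set set" where
  "H2_Phi \<Gamma> A G \<rho> \<theta> = (\<Union>\<beta>\<in>Phi \<Gamma> A G \<rho> \<theta>. H2 \<Gamma> A \<beta>)"

definition conj_cocycle ::
    "'s top_group \<Rightarrow> ('s, 'a) gamma_group \<Rightarrow> ('s, 'g) gamma_group \<Rightarrow> ('g \<Rightarrow> 'a \<Rightarrow> 'a) \<Rightarrow> 'g \<Rightarrow>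
     ('s \<times> 's \<Rightarrow> 'a) \<times> ('s \<Rightarrow> 'a \<Rightarrow> 'a) \<Rightarrow> ('s \<times> 's \<Rightarrow> 'a) \<times> ('s \<Rightarrow> 'a \<Rightarrow> 'a)" where
  "conj_cocycle \<Gamma> A G \<theta> g = (\<lambda>(u, f).
     (\<lambda>(\<sigma>, \<tau>)\<in>carrier \<Gamma> \<times> carrier \<Gamma>. \<theta> (inv\<^bsub>G\<^esub> g) (u (\<sigma>, \<tau>)),
      \<lambda>\<sigma>\<in>carrier \<Gamma>. \<theta> (inv\<^bsub>G\<^esub> g) \<otimes>\<^bsub>AutoGroup A\<^esub> f \<sigma> \<otimes>\<^bsub>AutoGroup A\<^esub> \<theta> g))"

text \<open>
  Maps on classes induced by a map \<open>F\<close> on cocycles: \<open>the_elem (F ` x)\<close> is the common value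
  of \<open>F\<close> on all representatives of the class \<open>x\<close>.
\<close>

definition conj_class ::
    "'s top_group \<Rightarrow> ('s, 'a) gamma_group \<Rightarrow> ('s, 'g) gamma_group \<Rightarrow> ('g \<Rightarrow> 'a \<Rightarrow> 'a) \<Rightarrow> 'g \<Rightarrow>
     (('s \<times> 's \<Rightarrow> 'a) \<times> ('s \<Rightarrow> 'a \<Rightarrow> 'a)) set \<Rightarrow>
     (('s \<times> 's \<Rightarrow> 'a) \<times> ('s \<Rightarrow> 'a \<Rightarrow> 'a)) set" where
  "conj_class \<Gamma> A G \<theta> g x =
     the_elem ((\<lambda>z. H2_class \<Gamma> A (conj_cocycle \<Gamma> A G \<theta> g z)) ` x)"

definition G_orbit ::
    "'s top_group \<Rightarrow> ('s, 'a) gamma_group \<Rightarrow> ('s, 'g) gamma_group \<Rightarrow> ('g \<Rightarrow> 'a \<Rightarrow> 'a) \<Rightarrow>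
     (('s \<times> 's \<Rightarrow> 'a) \<times> ('s \<Rightarrow> 'a \<Rightarrow> 'a)) set \<Rightarrow>
     (('s \<times> 's \<Rightarrow> 'a) \<times> ('s \<Rightarrow> 'a \<Rightarrow> 'a)) set set" where
  "G_orbit \<Gamma> A G \<theta> x = (\<lambda>g. conj_class \<Gamma> A G \<theta> g x) ` carrier G"

definition H2_rel ::
    "'s top_group \<Rightarrow> ('s, 'a) gamma_group \<Rightarrow> ('s, 'g) gamma_group \<Rightarrow> ('a \<Rightarrow> 'g) \<Rightarrow>
     ('g \<Rightarrow> 'a \<Rightarrow> 'a) \<Rightarrow> (('s \<times> 's \<Rightarrow> 'a) \<times> ('s \<Rightarrow> 'a \<Rightarrow> 'a)) set set set" where
  "H2_rel \<Gamma> A G \<rho> \<theta> = G_orbit \<Gamma> A G \<theta> ` H2_Phi \<Gamma> A G \<rho> \<theta>"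

definition neutral_elements ::
    "'s top_group \<Rightarrow> ('s, 'a) gamma_group \<Rightarrow> ('s, 'g) gamma_group \<Rightarrow> ('a \<Rightarrow> 'g) \<Rightarrow>
     ('g \<Rightarrow> 'a \<Rightarrow> 'a) \<Rightarrow> (('s \<times> 's \<Rightarrow> 'a) \<times> ('s \<Rightarrow> 'a \<Rightarrow> 'a)) set set set" where
  "neutral_elements \<Gamma> A G \<rho> \<theta> = {\<omega> \<in> H2_rel \<Gamma> A G \<rho> \<theta>.
     \<exists>\<beta>\<in>Phi \<Gamma> A G \<rho> \<theta>. \<exists>x\<in>H2 \<Gamma> A \<beta>. x \<in> \<omega> \<and> neutral_class \<Gamma> A x}"

definition rho_star ::
    "'s top_group \<Rightarrow> ('s, 'a) gamma_group \<Rightarrow> ('s, 'g) gamma_group \<Rightarrow> ('a \<Rightarrow> 'g) \<Rightarrow>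
     ('s \<Rightarrow> 'a) set \<Rightarrow> ('s \<Rightarrow> 'g) set" where
  "rho_star \<Gamma> A G \<rho> x = the_elem ((\<lambda>c. H1_class \<Gamma> G (\<lambda>\<sigma>\<in>carrier \<Gamma>. \<rho> (c \<sigma>))) ` x)"

definition i_star ::
    "'s top_group \<Rightarrow> ('s, 'a) gamma_group \<Rightarrow> ('s, 'g) gamma_group \<Rightarrow> ('a \<Rightarrow> 'g) \<Rightarrow>
     ('g \<Rightarrow> 'a \<Rightarrow> 'a) \<Rightarrow> ('s \<Rightarrow> 'g) set \<Rightarrow> (('s \<times> 's \<Rightarrow> 'a) \<times> ('s \<Rightarrow> 'g)) set" where
  "i_star \<Gamma> A G \<rho> \<theta> x = the_elem ((\<lambda>c. H1_cm_class \<Gamma> A G \<rho> \<theta> (one2 \<Gamma> A, c)) ` x)"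

definition Delta ::
    "'s top_group \<Rightarrow> ('s, 'a) gamma_group \<Rightarrow> ('g \<Rightarrow> 'a \<Rightarrow> 'a) \<Rightarrow>
     ('s \<times> 's \<Rightarrow> 'a) \<times> ('s \<Rightarrow> 'g) \<Rightarrow> (('s \<times> 's \<Rightarrow> 'a) \<times> ('s \<Rightarrow> 'a \<Rightarrow> 'a)) set" where
  "Delta \<Gamma> A \<theta> = (\<lambda>(u, \<psi>). H2_class \<Gamma> A (u, aut_part \<Gamma> A \<theta> \<psi>))"

definition Delta_rel ::
    "'s top_group \<Rightarrow> ('s, 'a) gamma_group \<Rightarrow> ('s, 'g) gamma_group \<Rightarrow> ('g \<Rightarrow> 'a \<Rightarrow> 'a) \<Rightarrow>
     (('s \<times> 's \<Rightarrow> 'a) \<times> ('s \<Rightarrow> 'g)) set \<Rightarrow>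
     (('s \<times> 's \<Rightarrow> 'a) \<times> ('s \<Rightarrow> 'a \<Rightarrow> 'a)) set set" where
  "Delta_rel \<Gamma> A G \<theta> x = the_elem ((\<lambda>z. G_orbit \<Gamma> A G \<theta> (Delta \<Gamma> A \<theta> z)) ` x)"

end

theory Submission
  imports Defs
begin

text \<open>
  Write \<open>z * (\<phi>, g)\<close> for the right action of \<open>Maps(\<Gamma>, A) \<times> G\<close> on the cocycles
  \<open>z = (u, \<psi>)\<close>, so that the class of \<open>z\<close> in \<open>H\<^sup>1(\<Gamma>, A \<rightarrow> G)\<close> is its orbit, and \<open>D z = (u, f)\<close>
  for the cocycle with values in \<open>Aut(A)\<close> that \<open>z\<close> defines.

  The theorem rests on the fact that \<open>D\<close> turns this single action into the two actions from
  which \<open>H\<^sup>2(\<Gamma>, A rel G)\<close> is built: \<open>D (z * (w, 1))\<close> is the transform of \<open>D z\<close> by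
  \<open>w \<in> Maps(\<Gamma>, A)\<close>, because \<open>\<theta>\<^bsub>\<rho>(a)\<^esub>\<close> is the inner automorphism of \<open>a\<close>
  (\<open>Maps_act_aut_cocycle\<close>), and \<open>D (z * (1, g))\<close> is the conjugate of \<open>D z\<close> by \<open>g\<close>, because
  the action of \<open>\<sigma>\<close> carries \<open>\<theta>\<^bsub>g\<^esub>\<close> to the automorphism of \<open>\<^sup>\<sigma>g\<close> (\<open>conj_aut_cocycle\<close>). Hence the class of \<open>D z\<close>
  in \<open>H\<^sup>2\<close> is the \<open>D\<close>-image of the \<open>Maps(\<Gamma>, A)\<close>-orbit of \<open>z\<close>. As \<open>Maps(\<Gamma>, A) \<times> 1\<close> is normal
  and \<open>(w, g) = (w, 1) (1, g)\<close>, the orbit \<open>\<Delta>(z)\<^sub>G\<close> consists of the classes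
  of \<open>D z'\<close> with \<open>z'\<close> in the class of \<open>z\<close> (\<open>G_orbit_Delta\<close>). In particular it depends on
  the class of \<open>z\<close> only.

  So \<open>\<Delta>(z)\<^sub>G\<close> is neutral exactly if the class of \<open>z\<close> contains a pair with first component \<open>1\<close>
  (\<open>G_orbit_neutral_iff\<close>). Such a pair \<open>(1, c)\<close> is a cocycle exactly if \<open>c\<close> is a cocycle with values
  in \<open>G\<close>, so this is also the condition for the class of \<open>z\<close> to be a value of \<open>i\<^sub>*\<close>
  (\<open>mem_image_i_star_iff\<close>).

  For exactness at \<open>H\<^sup>1(\<Gamma>, G)\<close>, the first component of \<open>(1, 1) * (\<phi>, g)\<close> is
  \<open>\<phi>\<^bsub>\<sigma>\<tau>\<^esub> (\<phi>\<^bsub>\<sigma>\<^esub> \<^sup>\<sigma>\<phi>\<^bsub>\<tau>\<^esub>)\<^sup>-\<^sup>1\<close> up to an automorphism of \<open>A\<close>. It is trivial exactly if \<open>\<phi>\<close> is a cocycle,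
  and the second component is then cohomologous to \<open>\<rho> \<circ> \<phi>\<close> (\<open>i_star_base_iff\<close>).
\<close>

section \<open>Cancellation in groups and locally constant maps\<close>

lemma (in group) inv_mult_cancel_left [simp]:
  assumes "x \<in> carrier G" "y \<in> carrier G"
  shows "inv x \<otimes> (x \<otimes> y) = y" "x \<otimes> (inv x \<otimes> y) = y"
  using assms by (simp_all flip: m_assoc)

text \<open>
  This evaluates the maps on classes: one representative together with the independence of the choice
  determines the value.
\<close>

lemma the_elem_image_const:
  assumes "c \<in> S" "\<And>d. d \<in> S \<Longrightarrow> F d = y"
  shows "the_elem (F ` S) = y"
proof -
  have "F ` S = {y}" using assms by auto
  then show ?thesis by simp
qed

lemma MapsD:
  assumes "f \<in> Maps X B"
  shows "continuous_map X (discrete_topology (carrier B)) f" "f \<in> extensional (topspace X)"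
    and "x \<in> topspace X \<Longrightarrow> f x \<in> carrier B"
  using assms continuous_map_funspace[of X "discrete_topology (carrier B)" f]
  by (auto simp: Maps_def)

lemma restrict_mem_Maps:
  assumes "continuous_map X (discrete_topology (carrier B)) f" "topspace X = S"
  shows "restrict f S \<in> Maps X B"
proof -
  have "continuous_map X (discrete_topology (carrier B)) (restrict f S)"
    using assms(1) by (rule continuous_map_eq) (simp add: assms(2))
  then show ?thesis by (simp add: Maps_def assms(2))
qed

section \<open>Groups with a continuous action\<close>

locale gamma_group = \<Gamma>: profinite_group \<Gamma>
  for \<Gamma> :: "'s top_group" and B :: "('s, 'b) gamma_group" +
  assumes gamma: "is_gamma_group \<Gamma> B"
begin

sublocale B: group B
  using gamma by (simp add: is_gamma_group_def)

lemma act_auto: "\<sigma> \<in> carrier \<Gamma> \<Longrightarrow> gact B \<sigma> \<in> auto B"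
  using gamma by (auto simp: is_gamma_group_def hom_def carrier_AutoGroup)

lemma act_closed [simp]:
  "\<sigma> \<in> carrier \<Gamma> \<Longrightarrow> b \<in> carrier B \<Longrightarrow> gact B \<sigma> b \<in> carrier B"
  by (simp add: act_auto auto_closed)

lemma act_mult [simp]:
  "\<sigma> \<in> carrier \<Gamma> \<Longrightarrow> b \<in> carrier B \<Longrightarrow> c \<in> carrier B \<Longrightarrow>
    gact B \<sigma> (b \<otimes>\<^bsub>B\<^esub> c) = gact B \<sigma> b \<otimes>\<^bsub>B\<^esub> gact B \<sigma> c"
  by (simp add: act_auto auto_mult)

lemma act_inv [simp]:
  "\<sigma> \<in> carrier \<Gamma> \<Longrightarrow> b \<in> carrier B \<Longrightarrow> gact B \<sigma> (inv\<^bsub>B\<^esub> b) = inv\<^bsub>B\<^esub> (gact B \<sigma> b)"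
  by (simp add: act_auto auto_inv B.is_group)

lemma act_one [simp]: "\<sigma> \<in> carrier \<Gamma> \<Longrightarrow> gact B \<sigma> \<one>\<^bsub>B\<^esub> = \<one>\<^bsub>B\<^esub>"
  using act_mult[of \<sigma> "\<one>\<^bsub>B\<^esub>" "\<one>\<^bsub>B\<^esub>"] act_closed[of \<sigma> "\<one>\<^bsub>B\<^esub>"]
  by (metis B.one_closed B.r_one B.l_cancel_one')

lemma act_act [simp]:
  assumes "\<sigma> \<in> carrier \<Gamma>" "\<tau> \<in> carrier \<Gamma>" "b \<in> carrier B"
  shows "gact B (\<sigma> \<otimes>\<^bsub>\<Gamma>\<^esub> \<tau>) b = gact B \<sigma> (gact B \<tau> b)"
proof -
  have "gact B (\<sigma> \<otimes>\<^bsub>\<Gamma>\<^esub> \<tau>) = compose (carrier B) (gact B \<sigma>) (gact B \<tau>)"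
    using gamma assms by (simp add: is_gamma_group_def hom_def act_auto flip: mult_AutoGroup)
  then show ?thesis using assms by (simp add: compose_def)
qed

lemma continuous_act:
  assumes "continuous_map X (gtop \<Gamma>) s" "continuous_map X (discrete_topology (carrier B)) f"
  shows "continuous_map X (discrete_topology (carrier B)) (\<lambda>x. gact B (s x) (f x))"
proof -
  have "continuous_map X (prod_topology (gtop \<Gamma>) (discrete_topology (carrier B))) (\<lambda>x. (s x, f x))"
    using assms by (simp add: continuous_map_pairedI)
  moreover have "continuous_map (prod_topology (gtop \<Gamma>) (discrete_topology (carrier B)))
      (discrete_topology (carrier B)) (\<lambda>(\<sigma>, b). gact B \<sigma> b)"
    using gamma by (simp add: is_gamma_group_def)
  ultimately have "continuous_map X (discrete_topology (carrier B))
      ((\<lambda>(\<sigma>, b). gact B \<sigma> b) \<circ> (\<lambda>x. (s x, f x)))"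
    by (rule continuous_map_compose)
  then show ?thesis by (simp add: o_def)
qed

lemma Maps_closed [simp]:
  "f \<in> Maps (gtop \<Gamma>) B \<Longrightarrow> \<sigma> \<in> carrier \<Gamma> \<Longrightarrow> f \<sigma> \<in> carrier B"
  by (auto intro: MapsD(3) simp: \<Gamma>.topspace_gtop)

lemma Maps2_closed [simp]:
  "u \<in> Maps (prod_topology (gtop \<Gamma>) (gtop \<Gamma>)) B \<Longrightarrow> \<sigma> \<in> carrier \<Gamma> \<Longrightarrow> \<tau> \<in> carrier \<Gamma> \<Longrightarrow>
    u (\<sigma>, \<tau>) \<in> carrier B"
  by (auto intro: MapsD(3) simp: \<Gamma>.topspace_gtop)

lemma continuous_mult:
  assumes "continuous_map X (discrete_topology (carrier B)) f"
    and "continuous_map X (discrete_topology (carrier B)) h"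
  shows "continuous_map X (discrete_topology (carrier B)) (\<lambda>x. f x \<otimes>\<^bsub>B\<^esub> h x)"
  by (rule continuous_map_discrete_map2[OF assms]) simp

lemma continuous_inv:
  assumes "continuous_map X (discrete_topology (carrier B)) f"
  shows "continuous_map X (discrete_topology (carrier B)) (\<lambda>x. inv\<^bsub>B\<^esub> f x)"
  by (rule continuous_map_discrete_map2[OF assms assms, where h = "\<lambda>s t. inv\<^bsub>B\<^esub> s"]) simp

lemma continuous_const:
  "b \<in> carrier B \<Longrightarrow> continuous_map X (discrete_topology (carrier B)) (\<lambda>x. b)"
  by simp

lemma Z1D:
  assumes "c \<in> Z1 \<Gamma> B"
  shows "c \<in> Maps (gtop \<Gamma>) B"
    and "\<sigma> \<in> carrier \<Gamma> \<Longrightarrow> \<tau> \<in> carrier \<Gamma> \<Longrightarrow>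
      c (\<sigma> \<otimes>\<^bsub>\<Gamma>\<^esub> \<tau>) = c \<sigma> \<otimes>\<^bsub>B\<^esub> gact B \<sigma> (c \<tau>)"
  using assms by (auto simp: Z1_def)

lemma H1_class_refl:
  assumes c: "c \<in> Z1 \<Gamma> B"
  shows "c \<in> H1_class \<Gamma> B c"
proof -
  have "c = (\<lambda>\<sigma>\<in>carrier \<Gamma>. inv\<^bsub>B\<^esub> \<one>\<^bsub>B\<^esub> \<otimes>\<^bsub>B\<^esub> c \<sigma> \<otimes>\<^bsub>B\<^esub> gact B \<sigma> \<one>\<^bsub>B\<^esub>)"
    by (rule extensionalityI[OF MapsD(2)[OF Z1D(1)[OF c]]])
      (use Z1D(1)[OF c] in \<open>auto simp: \<Gamma>.topspace_gtop\<close>)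
  then show ?thesis unfolding H1_class_def by blast
qed

lemma H1_class_eq:
  assumes c: "c \<in> Maps (gtop \<Gamma>) B" and d: "d \<in> H1_class \<Gamma> B c"
  shows "H1_class \<Gamma> B d = H1_class \<Gamma> B c"
proof -
  define tw where "tw c b = (\<lambda>\<sigma>\<in>carrier \<Gamma>. inv\<^bsub>B\<^esub> b \<otimes>\<^bsub>B\<^esub> c \<sigma> \<otimes>\<^bsub>B\<^esub> gact B \<sigma> b)" for c b
  have tw: "H1_class \<Gamma> B c = tw c ` carrier B" for c
    by (simp add: H1_class_def tw_def)
  obtain b where b: "b \<in> carrier B" and d_eq: "d = tw c b"
    using d unfolding tw by auto
  have comp: "tw d x = tw c (b \<otimes>\<^bsub>B\<^esub> x)" if "x \<in> carrier B" for x
    unfolding d_eq tw_def using that b c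
    by (intro restrict_ext) (simp add: B.m_assoc B.inv_mult_group)
  show ?thesis unfolding tw
  proof (intro subset_antisym image_subsetI)
    fix x assume x: "x \<in> carrier B"
    show "tw d x \<in> tw c ` carrier B" using comp[OF x] x b by simp
    have "tw c x = tw d (inv\<^bsub>B\<^esub> b \<otimes>\<^bsub>B\<^esub> x)" using x b by (simp add: comp)
    then show "tw c x \<in> tw d ` carrier B" using x b by simp
  qed
qed

end

section \<open>Crossed modules of groups with action\<close>

locale profinite_crossed_module = \<Gamma>: profinite_group \<Gamma> + crossed_module \<Gamma> A G \<rho> \<theta>
  for \<Gamma> :: "'s top_group" and A :: "('s, 'a) gamma_group" and G :: "('s, 'g) gamma_group"
    and \<rho> :: "'a \<Rightarrow> 'g" and \<theta> :: "'g \<Rightarrow> 'a \<Rightarrow> 'a"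
begin

sublocale A: gamma_group \<Gamma> A
  by unfold_locales (rule gamma_A)

sublocale G: gamma_group \<Gamma> G
  by unfold_locales (rule gamma_G)

sublocale \<rho>: group_hom A G \<rho>
  by unfold_locales (rule rho_hom)

lemma theta_auto: "g \<in> carrier G \<Longrightarrow> \<theta> g \<in> auto A"
  using theta_hom by (auto simp: hom_def carrier_AutoGroup)

lemma theta_closed [simp]: "g \<in> carrier G \<Longrightarrow> a \<in> carrier A \<Longrightarrow> \<theta> g a \<in> carrier A"
  by (simp add: theta_auto auto_closed)

lemma theta_mult [simp]:
  "g \<in> carrier G \<Longrightarrow> a \<in> carrier A \<Longrightarrow> b \<in> carrier A \<Longrightarrow>
    \<theta> g (a \<otimes>\<^bsub>A\<^esub> b) = \<theta> g a \<otimes>\<^bsub>A\<^esub> \<theta> g b"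
  by (simp add: theta_auto auto_mult)

lemma theta_inv [simp]:
  "g \<in> carrier G \<Longrightarrow> a \<in> carrier A \<Longrightarrow> \<theta> g (inv\<^bsub>A\<^esub> a) = inv\<^bsub>A\<^esub> (\<theta> g a)"
  by (simp add: theta_auto auto_inv A.B.is_group)

lemma theta_one [simp]: "g \<in> carrier G \<Longrightarrow> \<theta> g \<one>\<^bsub>A\<^esub> = \<one>\<^bsub>A\<^esub>"
  by (metis A.B.l_inv A.B.one_closed A.B.inv_one A.B.r_one theta_closed theta_inv theta_mult)

lemma theta_theta [simp]:
  assumes "g \<in> carrier G" "h \<in> carrier G" "a \<in> carrier A"
  shows "\<theta> (g \<otimes>\<^bsub>G\<^esub> h) a = \<theta> g (\<theta> h a)"
proof -
  have "\<theta> (g \<otimes>\<^bsub>G\<^esub> h) = compose (carrier A) (\<theta> g) (\<theta> h)"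
    using theta_hom assms by (simp add: hom_def theta_auto flip: mult_AutoGroup)
  then show ?thesis using assms by (simp add: compose_def)
qed

lemma theta_id [simp]:
  assumes "a \<in> carrier A" shows "\<theta> \<one>\<^bsub>G\<^esub> a = a"
  using peiffer[OF A.B.one_closed assms] assms by simp

lemma theta_inv_theta [simp]:
  assumes "g \<in> carrier G" "a \<in> carrier A"
  shows "\<theta> (inv\<^bsub>G\<^esub> g) (\<theta> g a) = a" "\<theta> g (\<theta> (inv\<^bsub>G\<^esub> g) a) = a"
  using assms by (simp_all flip: theta_theta)

declare rho_equivariant [simp] peiffer [simp] rho_theta [simp] theta_equivariant [simp]

lemma continuous_theta:
  assumes "continuous_map X (discrete_topology (carrier G)) f"
    and "continuous_map X (discrete_topology (carrier A)) h"
  shows "continuous_map X (discrete_topology (carrier A)) (\<lambda>x. \<theta> (f x) (h x))"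
  by (rule continuous_map_discrete_map2[OF assms]) simp

lemma continuous_rho:
  assumes "continuous_map X (discrete_topology (carrier A)) f"
  shows "continuous_map X (discrete_topology (carrier G)) (\<lambda>x. \<rho> (f x))"
  by (rule continuous_map_discrete_map2[OF assms assms, where h = "\<lambda>s t. \<rho> s"]) simp

lemmas continuous_cochain_intros =
  A.continuous_act A.continuous_mult A.continuous_inv
  G.continuous_act G.continuous_mult G.continuous_inv G.continuous_const
  continuous_theta continuous_rho

section \<open>The orbits of hypercocycles\<close>

text \<open>
  The last two facts are solved for \<open>\<psi>\<^bsub>\<sigma>\<tau>\<^esub>\<close> and \<open>u\<^bsub>\<sigma>,\<tau>\<upsilon>\<^esub>\<close>. Used as rewrite rules in this direction, together
  with the axioms of a crossed module, they bring both sides of the cocycle identities below to the same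
  reduced word.
\<close>

lemma Z1_cmD:
  assumes "(u, \<psi>) \<in> Z1_cm \<Gamma> A G \<rho> \<theta>"
  shows "u \<in> Maps (prod_topology (gtop \<Gamma>) (gtop \<Gamma>)) A" "\<psi> \<in> Maps (gtop \<Gamma>) G"
    and "\<sigma> \<in> carrier \<Gamma> \<Longrightarrow> \<tau> \<in> carrier \<Gamma> \<Longrightarrow>
      \<psi> (\<sigma> \<otimes>\<^bsub>\<Gamma>\<^esub> \<tau>) = \<rho> (u (\<sigma>, \<tau>)) \<otimes>\<^bsub>G\<^esub> \<psi> \<sigma> \<otimes>\<^bsub>G\<^esub> gact G \<sigma> (\<psi> \<tau>)"
    and "\<sigma> \<in> carrier \<Gamma> \<Longrightarrow> \<tau> \<in> carrier \<Gamma> \<Longrightarrow> \<upsilon> \<in> carrier \<Gamma> \<Longrightarrow>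
      u (\<sigma>, \<tau> \<otimes>\<^bsub>\<Gamma>\<^esub> \<upsilon>) =
        u (\<sigma> \<otimes>\<^bsub>\<Gamma>\<^esub> \<tau>, \<upsilon>) \<otimes>\<^bsub>A\<^esub> u (\<sigma>, \<tau>) \<otimes>\<^bsub>A\<^esub> inv\<^bsub>A\<^esub> (\<theta> (\<psi> \<sigma>) (gact A \<sigma> (u (\<tau>, \<upsilon>))))"
proof -
  show u: "u \<in> Maps (prod_topology (gtop \<Gamma>) (gtop \<Gamma>)) A" and psi: "\<psi> \<in> Maps (gtop \<Gamma>) G"
    using assms by (auto simp: Z1_cm_def)
  show "\<sigma> \<in> carrier \<Gamma> \<Longrightarrow> \<tau> \<in> carrier \<Gamma> \<Longrightarrow>
      \<psi> (\<sigma> \<otimes>\<^bsub>\<Gamma>\<^esub> \<tau>) = \<rho> (u (\<sigma>, \<tau>)) \<otimes>\<^bsub>G\<^esub> \<psi> \<sigma> \<otimes>\<^bsub>G\<^esub> gact G \<sigma> (\<psi> \<tau>)"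
    using assms by (simp add: Z1_cm_def)
  assume s: "\<sigma> \<in> carrier \<Gamma>" "\<tau> \<in> carrier \<Gamma>" "\<upsilon> \<in> carrier \<Gamma>"
  have "u (\<sigma>, \<tau> \<otimes>\<^bsub>\<Gamma>\<^esub> \<upsilon>) \<otimes>\<^bsub>A\<^esub> \<theta> (\<psi> \<sigma>) (gact A \<sigma> (u (\<tau>, \<upsilon>))) =
      u (\<sigma> \<otimes>\<^bsub>\<Gamma>\<^esub> \<tau>, \<upsilon>) \<otimes>\<^bsub>A\<^esub> u (\<sigma>, \<tau>)"
    using assms s by (simp add: Z1_cm_def)
  then show "u (\<sigma>, \<tau> \<otimes>\<^bsub>\<Gamma>\<^esub> \<upsilon>) =
      u (\<sigma> \<otimes>\<^bsub>\<Gamma>\<^esub> \<tau>, \<upsilon>) \<otimes>\<^bsub>A\<^esub> u (\<sigma>, \<tau>) \<otimes>\<^bsub>A\<^esub> inv\<^bsub>A\<^esub> (\<theta> (\<psi> \<sigma>) (gact A \<sigma> (u (\<tau>, \<upsilon>))))"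
    using u psi s by (subst A.B.inv_solve_right) auto
qed

lemma Z1_cmI:
  assumes "u \<in> Maps (prod_topology (gtop \<Gamma>) (gtop \<Gamma>)) A" "\<psi> \<in> Maps (gtop \<Gamma>) G"
    and "\<And>\<sigma> \<tau>. \<sigma> \<in> carrier \<Gamma> \<Longrightarrow> \<tau> \<in> carrier \<Gamma> \<Longrightarrow>
        \<rho> (u (\<sigma>, \<tau>)) \<otimes>\<^bsub>G\<^esub> \<psi> \<sigma> \<otimes>\<^bsub>G\<^esub> gact G \<sigma> (\<psi> \<tau>) = \<psi> (\<sigma> \<otimes>\<^bsub>\<Gamma>\<^esub> \<tau>)"
    and "\<And>\<sigma> \<tau> \<upsilon>. \<sigma> \<in> carrier \<Gamma> \<Longrightarrow> \<tau> \<in> carrier \<Gamma> \<Longrightarrow> \<upsilon> \<in> carrier \<Gamma> \<Longrightarrow>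
        u (\<sigma>, \<tau> \<otimes>\<^bsub>\<Gamma>\<^esub> \<upsilon>) \<otimes>\<^bsub>A\<^esub> \<theta> (\<psi> \<sigma>) (gact A \<sigma> (u (\<tau>, \<upsilon>))) =
        u (\<sigma> \<otimes>\<^bsub>\<Gamma>\<^esub> \<tau>, \<upsilon>) \<otimes>\<^bsub>A\<^esub> u (\<sigma>, \<tau>)"
  shows "(u, \<psi>) \<in> Z1_cm \<Gamma> A G \<rho> \<theta>"
  using assms by (simp add: Z1_cm_def)

lemma continuous_Maps_comp:
  assumes "f \<in> Maps (gtop \<Gamma>) B" "continuous_map X (gtop \<Gamma>) s"
  shows "continuous_map X (discrete_topology (carrier B)) (\<lambda>x. f (s x))"
  using continuous_map_compose[OF assms(2) MapsD(1)[OF assms(1)]] by (simp add: o_def)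

lemma continuous_projections:
  "continuous_map (prod_topology (gtop \<Gamma>) (gtop \<Gamma>)) (gtop \<Gamma>) fst"
  "continuous_map (prod_topology (gtop \<Gamma>) (gtop \<Gamma>)) (gtop \<Gamma>) snd"
  "continuous_map (prod_topology (gtop \<Gamma>) (gtop \<Gamma>)) (gtop \<Gamma>) (\<lambda>p. fst p \<otimes>\<^bsub>\<Gamma>\<^esub> snd p)"
  using \<Gamma>.continuous_mult by (simp_all add: continuous_map_fst continuous_map_snd case_prod_unfold)

text \<open>
  In the first identity \<open>\<rho>(u'\<^bsub>\<sigma>,\<tau>\<^esub>)\<close> is a conjugate by \<open>g\<^sup>-\<^sup>1\<close>, as \<open>\<rho>\<close> carries the action of \<open>G\<close> on \<open>A\<close>
  to conjugation, and its factors \<open>\<rho>(\<phi>\<^bsub>\<sigma>\<^esub>)\<^sup>-\<^sup>1\<close> and \<open>\<psi>\<^bsub>\<sigma>\<^esub> \<rho>(\<^sup>\<sigma>\<phi>\<^bsub>\<tau>\<^esub>)\<^sup>-\<^sup>1 \<psi>\<^bsub>\<sigma>\<^esub>\<^sup>-\<^sup>1\<close> cancel against \<open>\<psi>'\<^bsub>\<sigma>\<^esub>\<close> and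
  \<open>\<^sup>\<sigma>\<psi>'\<^bsub>\<tau>\<^esub>\<close>. In the second one, \<open>g\<close> cancels because \<open>\<psi>'\<^bsub>\<sigma>\<^esub>\<close> ends in \<open>\<^sup>\<sigma>g\<close>, and \<open>\<rho>(\<phi>\<^bsub>\<sigma>\<^esub>)\<close> acts as conjugation
  by \<open>\<phi>\<^bsub>\<sigma>\<^esub>\<close>, after which the values of \<open>\<phi>\<close> telescope.
\<close>

lemma cm_act_mem_Z1_cm:
  assumes z: "z \<in> Z1_cm \<Gamma> A G \<rho> \<theta>" and phi: "\<phi> \<in> Maps (gtop \<Gamma>) A" and g: "g \<in> carrier G"
  shows "cm_act \<Gamma> A G \<rho> \<theta> z (\<phi>, g) \<in> Z1_cm \<Gamma> A G \<rho> \<theta>"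
proof -
  obtain u \<psi> where z_eq: "z = (u, \<psi>)" by (cases z)
  note zD = Z1_cmD[OF z[unfolded z_eq]]
  note u = zD(1) and psi = zD(2)
  obtain u' \<psi>' where act: "cm_act \<Gamma> A G \<rho> \<theta> z (\<phi>, g) = (u', \<psi>')"
    by (cases "cm_act \<Gamma> A G \<rho> \<theta> z (\<phi>, g)")
  have u'_def: "u' = (\<lambda>(\<sigma>, \<tau>)\<in>carrier \<Gamma> \<times> carrier \<Gamma>.
      \<theta> (inv\<^bsub>G\<^esub> g) (\<phi> (\<sigma> \<otimes>\<^bsub>\<Gamma>\<^esub> \<tau>) \<otimes>\<^bsub>A\<^esub> u (\<sigma>, \<tau>) \<otimes>\<^bsub>A\<^esub>
        inv\<^bsub>A\<^esub> (\<theta> (\<psi> \<sigma>) (gact A \<sigma> (\<phi> \<tau>))) \<otimes>\<^bsub>A\<^esub> inv\<^bsub>A\<^esub> (\<phi> \<sigma>)))"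
    and psi'_def: "\<psi>' = (\<lambda>\<sigma>\<in>carrier \<Gamma>.
      inv\<^bsub>G\<^esub> g \<otimes>\<^bsub>G\<^esub> \<rho> (\<phi> \<sigma>) \<otimes>\<^bsub>G\<^esub> \<psi> \<sigma> \<otimes>\<^bsub>G\<^esub> gact G \<sigma> g)"
    using act by (simp_all add: cm_act_def z_eq)
  show ?thesis unfolding act
  proof (rule Z1_cmI)
    show "u' \<in> Maps (prod_topology (gtop \<Gamma>) (gtop \<Gamma>)) A"
      unfolding u'_def using MapsD(1)[OF u] g
      by (intro restrict_mem_Maps)
        (auto simp: case_prod_unfold \<Gamma>.topspace_gtop intro!: continuous_cochain_intros
          continuous_Maps_comp[OF phi] continuous_Maps_comp[OF psi] continuous_projections)
    show "\<psi>' \<in> Maps (gtop \<Gamma>) G"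
      unfolding psi'_def using g MapsD(1)[OF phi] MapsD(1)[OF psi]
      by (intro restrict_mem_Maps)
        (auto simp: \<Gamma>.topspace_gtop intro!: continuous_cochain_intros)
  next
    fix \<sigma> \<tau> assume "\<sigma> \<in> carrier \<Gamma>" "\<tau> \<in> carrier \<Gamma>"
    then show "\<rho> (u' (\<sigma>, \<tau>)) \<otimes>\<^bsub>G\<^esub> \<psi>' \<sigma> \<otimes>\<^bsub>G\<^esub> gact G \<sigma> (\<psi>' \<tau>) = \<psi>' (\<sigma> \<otimes>\<^bsub>\<Gamma>\<^esub> \<tau>)"
      using u psi phi g
      by (simp add: u'_def psi'_def zD(3) G.B.m_assoc G.B.inv_mult_group A.B.inv_mult_group)
  next
    fix \<sigma> \<tau> \<upsilon> assume "\<sigma> \<in> carrier \<Gamma>" "\<tau> \<in> carrier \<Gamma>" "\<upsilon> \<in> carrier \<Gamma>"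
    then show "u' (\<sigma>, \<tau> \<otimes>\<^bsub>\<Gamma>\<^esub> \<upsilon>) \<otimes>\<^bsub>A\<^esub> \<theta> (\<psi>' \<sigma>) (gact A \<sigma> (u' (\<tau>, \<upsilon>))) =
        u' (\<sigma> \<otimes>\<^bsub>\<Gamma>\<^esub> \<tau>, \<upsilon>) \<otimes>\<^bsub>A\<^esub> u' (\<sigma>, \<tau>)"
      using u psi phi g
      by (simp add: u'_def psi'_def zD(3,4) A.B.m_assoc G.B.m_assoc A.B.inv_mult_group \<Gamma>.m_assoc)
  qed
qed

lemma cm_act_cm_act:
  assumes z: "z \<in> Z1_cm \<Gamma> A G \<rho> \<theta>"
    and phi: "\<phi> \<in> Maps (gtop \<Gamma>) A" "\<phi>' \<in> Maps (gtop \<Gamma>) A"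
    and g: "g \<in> carrier G" "g' \<in> carrier G"
  shows "cm_act \<Gamma> A G \<rho> \<theta> (cm_act \<Gamma> A G \<rho> \<theta> z (\<phi>, g)) (\<phi>', g') =
    cm_act \<Gamma> A G \<rho> \<theta> z (\<lambda>\<sigma>\<in>carrier \<Gamma>. \<theta> g (\<phi>' \<sigma>) \<otimes>\<^bsub>A\<^esub> \<phi> \<sigma>, g \<otimes>\<^bsub>G\<^esub> g')"
proof -
  obtain u \<psi> where z_eq: "z = (u, \<psi>)" by (cases z)
  note zD = Z1_cmD[OF z[unfolded z_eq]]
  note u = zD(1) and psi = zD(2)
  show ?thesis
    unfolding z_eq cm_act_def prod.case
    using u psi phi g
    by (auto intro!: restrict_ext
      simp: A.B.m_assoc G.B.m_assoc A.B.inv_mult_group G.B.inv_mult_group)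
qed

abbreviation translate :: "('s \<times> 's \<Rightarrow> 'a) \<times> ('s \<Rightarrow> 'g) \<Rightarrow> ('s \<Rightarrow> 'a) \<Rightarrow> 'g \<Rightarrow>
    ('s \<times> 's \<Rightarrow> 'a) \<times> ('s \<Rightarrow> 'g)" where
  "translate z \<phi> g \<equiv> cm_act \<Gamma> A G \<rho> \<theta> z (\<phi>, g)"

abbreviation one1 :: "'s \<Rightarrow> 'a" where
  "one1 \<equiv> \<lambda>_\<in>carrier \<Gamma>. \<one>\<^bsub>A\<^esub>"

lemma one1_mem_Maps: "one1 \<in> Maps (gtop \<Gamma>) A"
  by (rule restrict_mem_Maps) (simp_all add: \<Gamma>.topspace_gtop)

lemma one2_mem_Maps: "one2 \<Gamma> A \<in> Maps (prod_topology (gtop \<Gamma>) (gtop \<Gamma>)) A"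
  by (rule restrict_mem_Maps) (simp_all add: \<Gamma>.topspace_gtop)

lemma restrict_mem_Maps_gtop:
  assumes "continuous_map (gtop \<Gamma>) (discrete_topology (carrier A)) f"
  shows "(\<lambda>\<sigma>\<in>carrier \<Gamma>. f \<sigma>) \<in> Maps (gtop \<Gamma>) A"
  using assms by (rule restrict_mem_Maps) (simp add: \<Gamma>.topspace_gtop)

lemma restrict_Maps [simp]:
  "\<phi> \<in> Maps (gtop \<Gamma>) B \<Longrightarrow> restrict \<phi> (carrier \<Gamma>) = \<phi>"
  by (metis MapsD(2) \<Gamma>.topspace_gtop extensional_restrict)

lemma cm_act_one:
  assumes z: "z \<in> Z1_cm \<Gamma> A G \<rho> \<theta>"
  shows "translate z one1 \<one>\<^bsub>G\<^esub> = z"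
proof -
  obtain u \<psi> where z_eq: "z = (u, \<psi>)" by (cases z)
  note zD = Z1_cmD[OF z[unfolded z_eq]]
  have "(\<lambda>(\<sigma>, \<tau>)\<in>carrier \<Gamma> \<times> carrier \<Gamma>. u (\<sigma>, \<tau>)) = u"
    using MapsD(2)[OF zD(1)] by (simp add: \<Gamma>.topspace_gtop extensional_restrict)
  moreover have "fst (translate z one1 \<one>\<^bsub>G\<^esub>) = (\<lambda>(\<sigma>, \<tau>)\<in>carrier \<Gamma> \<times> carrier \<Gamma>. u (\<sigma>, \<tau>))"
    using zD(1,2) by (auto simp: z_eq cm_act_def intro!: restrict_ext)
  moreover have "snd (translate z one1 \<one>\<^bsub>G\<^esub>) = restrict \<psi> (carrier \<Gamma>)"
    unfolding z_eq cm_act_def prod.case snd_conv using zD(1,2) by (intro restrict_ext) simp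
  ultimately show ?thesis using zD(2) by (simp add: z_eq prod_eq_iff)
qed

lemma H1_cm_class_refl:
  assumes "z \<in> Z1_cm \<Gamma> A G \<rho> \<theta>"
  shows "z \<in> H1_cm_class \<Gamma> A G \<rho> \<theta> z"
proof -
  have "(one1, \<one>\<^bsub>G\<^esub>) \<in> Maps (gtop \<Gamma>) A \<times> carrier G" using one1_mem_Maps by simp
  then show ?thesis
    unfolding H1_cm_class_def by (rule rev_image_eqI) (rule cm_act_one[OF assms, symmetric])
qed

lemma H1_cm_class_eq:
  assumes z: "z \<in> Z1_cm \<Gamma> A G \<rho> \<theta>" and z': "z' \<in> H1_cm_class \<Gamma> A G \<rho> \<theta> z"
  shows "H1_cm_class \<Gamma> A G \<rho> \<theta> z' = H1_cm_class \<Gamma> A G \<rho> \<theta> z"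
proof -
  obtain \<phi> g where phi: "\<phi> \<in> Maps (gtop \<Gamma>) A" and g: "g \<in> carrier G" and z'_eq: "z' = translate z \<phi> g"
    using z' unfolding H1_cm_class_def by auto
  have prod: "(\<lambda>\<sigma>\<in>carrier \<Gamma>. \<theta> g (\<phi>' \<sigma>) \<otimes>\<^bsub>A\<^esub> \<phi> \<sigma>) \<in> Maps (gtop \<Gamma>) A"
    if "\<phi>' \<in> Maps (gtop \<Gamma>) A" for \<phi>'
    using that phi g by (intro restrict_mem_Maps_gtop continuous_cochain_intros MapsD(1)) auto
  show ?thesis unfolding H1_cm_class_def
  proof (intro subset_antisym image_subsetI; clarify)
    fix \<phi>' g' assume k: "\<phi>' \<in> Maps (gtop \<Gamma>) A" "g' \<in> carrier G"
    show "translate z' \<phi>' g' \<in> cm_act \<Gamma> A G \<rho> \<theta> z ` (Maps (gtop \<Gamma>) A \<times> carrier G)"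
      unfolding z'_eq cm_act_cm_act[OF z phi k(1) g k(2)] using prod[OF k(1)] g k(2) by simp
    \<comment> \<open>The solution of \<open>(\<phi>, g) (x, g\<^sup>-\<^sup>1 g') = (\<phi>', g')\<close>.\<close>
    define x where "x = (\<lambda>\<sigma>\<in>carrier \<Gamma>. \<theta> (inv\<^bsub>G\<^esub> g) (\<phi>' \<sigma> \<otimes>\<^bsub>A\<^esub> inv\<^bsub>A\<^esub> (\<phi> \<sigma>)))"
    have x_Maps: "x \<in> Maps (gtop \<Gamma>) A"
      unfolding x_def using k(1) phi g
      by (intro restrict_mem_Maps_gtop continuous_cochain_intros MapsD(1)) auto
    have "restrict \<phi>' (carrier \<Gamma>) = (\<lambda>\<sigma>\<in>carrier \<Gamma>. \<theta> g (x \<sigma>) \<otimes>\<^bsub>A\<^esub> \<phi> \<sigma>)"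
      unfolding x_def using k(1) phi g by (intro restrict_ext) (simp add: A.B.m_assoc)
    then have "translate z \<phi>' g' = translate z' x (inv\<^bsub>G\<^esub> g \<otimes>\<^bsub>G\<^esub> g')"
      unfolding z'_eq using k g by (simp add: cm_act_cm_act[OF z phi x_Maps g])
    then show "translate z \<phi>' g' \<in> cm_act \<Gamma> A G \<rho> \<theta> z' ` (Maps (gtop \<Gamma>) A \<times> carrier G)"
      using x_Maps g k(2) by simp
  qed
qed

section \<open>The cocycle with values in automorphisms\<close>

sublocale Aut: group "AutoGroup A"
  by (rule A.B.AutoGroup)

lemma Aut_carrier [simp]: "carrier (AutoGroup A) = auto A"
  by (rule carrier_AutoGroup)

lemma Aut_mult_closed [simp]: "f \<in> auto A \<Longrightarrow> h \<in> auto A \<Longrightarrow> f \<otimes>\<^bsub>AutoGroup A\<^esub> h \<in> auto A"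
  using Aut.m_closed by simp

lemma Aut_inv_closed [simp]: "f \<in> auto A \<Longrightarrow> inv\<^bsub>AutoGroup A\<^esub> f \<in> auto A"
  using Aut.inv_closed by simp

lemma Aut_mult_apply [simp]:
  "f \<in> auto A \<Longrightarrow> h \<in> auto A \<Longrightarrow> a \<in> carrier A \<Longrightarrow> (f \<otimes>\<^bsub>AutoGroup A\<^esub> h) a = f (h a)"
  by (simp add: mult_AutoGroup compose_def)

lemma auto_eqI:
  assumes "f \<in> auto A" "h \<in> auto A" "\<And>a. a \<in> carrier A \<Longrightarrow> f a = h a"
  shows "f = h"
  using assms by (intro extensionalityI[of f "carrier A" h]) (auto simp: auto_def Bij_def)

lemma inn_apply [simp]: "x \<in> carrier A \<Longrightarrow> inn A a x = a \<otimes>\<^bsub>A\<^esub> x \<otimes>\<^bsub>A\<^esub> inv\<^bsub>A\<^esub> a"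
  by (simp add: inn_def)

lemma inn_auto [simp]: "a \<in> carrier A \<Longrightarrow> inn A a \<in> auto A"
  by (rule inn_mem_auto[OF A.B.is_group])

lemmas auto_intros [simp] = theta_auto A.act_auto

lemma aut_part_auto [simp]:
  "\<psi> \<in> Maps (gtop \<Gamma>) G \<Longrightarrow> \<sigma> \<in> carrier \<Gamma> \<Longrightarrow> aut_part \<Gamma> A \<theta> \<psi> \<sigma> \<in> auto A"
  by (simp add: aut_part_def)

lemma aut_part_apply [simp]:
  "\<psi> \<in> Maps (gtop \<Gamma>) G \<Longrightarrow> \<sigma> \<in> carrier \<Gamma> \<Longrightarrow> a \<in> carrier A \<Longrightarrow>
    aut_part \<Gamma> A \<theta> \<psi> \<sigma> a = \<theta> (\<psi> \<sigma>) (gact A \<sigma> a)"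
  by (simp add: aut_part_def)

text \<open>
  The representative of \<open>\<Delta>(u, \<psi>)\<close>, called \<open>D (u, \<psi>)\<close> above.
\<close>

definition aut_cocycle :: "('s \<times> 's \<Rightarrow> 'a) \<times> ('s \<Rightarrow> 'g) \<Rightarrow> ('s \<times> 's \<Rightarrow> 'a) \<times> ('s \<Rightarrow> 'a \<Rightarrow> 'a)" where
  "aut_cocycle = (\<lambda>(u, \<psi>). (u, aut_part \<Gamma> A \<theta> \<psi>))"

lemma Delta_eq: "Delta \<Gamma> A \<theta> z = H2_class \<Gamma> A (aut_cocycle z)"
  by (simp add: Delta_def aut_cocycle_def case_prod_unfold)

text \<open>
  The two second components agree because \<open>inn a = \<theta>\<^bsub>\<rho>(a)\<^esub>\<close>; the first components are the same formula.
\<close>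

lemma Maps_act_aut_cocycle:
  assumes z: "z \<in> Z1_cm \<Gamma> A G \<rho> \<theta>" and w: "w \<in> Maps (gtop \<Gamma>) A"
  shows "Maps_act \<Gamma> A w (aut_cocycle z) = aut_cocycle (translate z w \<one>\<^bsub>G\<^esub>)"
proof -
  obtain u \<psi> where z_eq: "z = (u, \<psi>)" by (cases z)
  note zD = Z1_cmD[OF z[unfolded z_eq]]
  have psi': "(\<lambda>\<sigma>\<in>carrier \<Gamma>. inv\<^bsub>G\<^esub> \<one>\<^bsub>G\<^esub> \<otimes>\<^bsub>G\<^esub> \<rho> (w \<sigma>) \<otimes>\<^bsub>G\<^esub> \<psi> \<sigma> \<otimes>\<^bsub>G\<^esub> gact G \<sigma> \<one>\<^bsub>G\<^esub>)
      \<in> Maps (gtop \<Gamma>) G" (is "?psi' \<in> _")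
    using Z1_cmD(2)[of "fst (translate z w \<one>\<^bsub>G\<^esub>)" "snd (translate z w \<one>\<^bsub>G\<^esub>)"]
      cm_act_mem_Z1_cm[OF z w G.B.one_closed] by (simp add: z_eq cm_act_def)
  have "inn A (w \<sigma>) \<otimes>\<^bsub>AutoGroup A\<^esub> aut_part \<Gamma> A \<theta> \<psi> \<sigma> = aut_part \<Gamma> A \<theta> ?psi' \<sigma>"
    if "\<sigma> \<in> carrier \<Gamma>" for \<sigma>
    by (rule auto_eqI) (use that w zD psi' in \<open>simp_all add: A.B.m_assoc\<close>)
  then have "restrict (\<lambda>\<sigma>. inn A (w \<sigma>) \<otimes>\<^bsub>AutoGroup A\<^esub> aut_part \<Gamma> A \<theta> \<psi> \<sigma>) (carrier \<Gamma>) =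
      restrict (aut_part \<Gamma> A \<theta> ?psi') (carrier \<Gamma>)"
    by (rule restrict_ext)
  then show ?thesis using zD(1,2) w
    by (auto simp: z_eq aut_cocycle_def Maps_act_def cm_act_def aut_part_def intro!: restrict_ext)
qed

text \<open>
  Here \<open>\<theta>\<^bsub>g\<^esub>\<close> has to be moved past the action of \<open>\<sigma>\<close>, and becomes \<open>\<theta>\<close> of \<open>\<^sup>\<sigma>g\<close>: this is the last
  factor of \<open>\<psi>'\<^bsub>\<sigma>\<^esub> = g\<^sup>-\<^sup>1 \<psi>\<^bsub>\<sigma>\<^esub> \<^sup>\<sigma>g\<close>.
\<close>

lemma conj_aut_cocycle:
  assumes z: "z \<in> Z1_cm \<Gamma> A G \<rho> \<theta>" and g: "g \<in> carrier G"
  shows "conj_cocycle \<Gamma> A G \<theta> g (aut_cocycle z) = aut_cocycle (translate z one1 g)"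
proof -
  obtain u \<psi> where z_eq: "z = (u, \<psi>)" by (cases z)
  note zD = Z1_cmD[OF z[unfolded z_eq]]
  have psi': "(\<lambda>\<sigma>\<in>carrier \<Gamma>. inv\<^bsub>G\<^esub> g \<otimes>\<^bsub>G\<^esub> \<rho> (one1 \<sigma>) \<otimes>\<^bsub>G\<^esub> \<psi> \<sigma> \<otimes>\<^bsub>G\<^esub> gact G \<sigma> g)
      \<in> Maps (gtop \<Gamma>) G" (is "?psi' \<in> _")
    using Z1_cmD(2)[of "fst (translate z one1 g)" "snd (translate z one1 g)"]
      cm_act_mem_Z1_cm[OF z one1_mem_Maps g] by (simp add: z_eq cm_act_def)
  have "\<theta> (inv\<^bsub>G\<^esub> g) \<otimes>\<^bsub>AutoGroup A\<^esub> aut_part \<Gamma> A \<theta> \<psi> \<sigma> \<otimes>\<^bsub>AutoGroup A\<^esub> \<theta> g =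
      aut_part \<Gamma> A \<theta> ?psi' \<sigma>"
    if "\<sigma> \<in> carrier \<Gamma>" for \<sigma>
    by (rule auto_eqI) (use that g zD psi' in \<open>simp_all add: A.B.m_assoc\<close>)
  then have "restrict (\<lambda>\<sigma>. \<theta> (inv\<^bsub>G\<^esub> g) \<otimes>\<^bsub>AutoGroup A\<^esub> aut_part \<Gamma> A \<theta> \<psi> \<sigma> \<otimes>\<^bsub>AutoGroup A\<^esub> \<theta> g)
        (carrier \<Gamma>) = restrict (aut_part \<Gamma> A \<theta> ?psi') (carrier \<Gamma>)"
    by (rule restrict_ext)
  then show ?thesis using zD(1,2) g
    by (auto simp: z_eq aut_cocycle_def conj_cocycle_def cm_act_def aut_part_def intro!: restrict_ext)
qed

section \<open>Comparison of orbits\<close>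

lemma H2_class_aut_cocycle:
  assumes z: "z \<in> Z1_cm \<Gamma> A G \<rho> \<theta>"
  shows "H2_class \<Gamma> A (aut_cocycle z) = (\<lambda>w. aut_cocycle (translate z w \<one>\<^bsub>G\<^esub>)) ` Maps (gtop \<Gamma>) A"
  unfolding H2_class_def using Maps_act_aut_cocycle[OF z] by (rule image_cong[OF refl])

text \<open>
  Products of an element of \<open>Maps(\<Gamma>, A)\<close> and an element of \<open>G\<close> in either order. The second form
  expresses that \<open>Maps(\<Gamma>, A)\<close> is normalised by \<open>G\<close>.
\<close>

lemma translate_factor:
  assumes z: "z \<in> Z1_cm \<Gamma> A G \<rho> \<theta>" and w: "w \<in> Maps (gtop \<Gamma>) A" and g: "g \<in> carrier G"
  shows "translate (translate z w \<one>\<^bsub>G\<^esub>) one1 g = translate z w g"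
    and "translate (translate z one1 g) w \<one>\<^bsub>G\<^esub> = translate z (\<lambda>\<sigma>\<in>carrier \<Gamma>. \<theta> g (w \<sigma>)) g"
proof -
  have "(\<lambda>\<sigma>\<in>carrier \<Gamma>. \<theta> \<one>\<^bsub>G\<^esub> (one1 \<sigma>) \<otimes>\<^bsub>A\<^esub> w \<sigma>) = restrict w (carrier \<Gamma>)"
    using w by (intro restrict_ext) simp
  then show "translate (translate z w \<one>\<^bsub>G\<^esub>) one1 g = translate z w g"
    using w g by (simp add: cm_act_cm_act[OF z w one1_mem_Maps])
  have "(\<lambda>\<sigma>\<in>carrier \<Gamma>. \<theta> g (w \<sigma>) \<otimes>\<^bsub>A\<^esub> one1 \<sigma>) = (\<lambda>\<sigma>\<in>carrier \<Gamma>. \<theta> g (w \<sigma>))"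
    using w g by (intro restrict_ext) simp
  then show "translate (translate z one1 g) w \<one>\<^bsub>G\<^esub> = translate z (\<lambda>\<sigma>\<in>carrier \<Gamma>. \<theta> g (w \<sigma>)) g"
    using w g by (simp add: cm_act_cm_act[OF z one1_mem_Maps w])
qed

text \<open>
  By \<open>H2_class_aut_cocycle\<close> the classes in \<open>H\<^sup>2\<close> are images of orbits of the group \<open>Maps(\<Gamma>, A)\<close>, and moving the base
  point inside an orbit does not change the orbit.
\<close>

lemma H2_class_translate_Maps:
  assumes z: "z \<in> Z1_cm \<Gamma> A G \<rho> \<theta>" and w: "w \<in> Maps (gtop \<Gamma>) A"
  shows "H2_class \<Gamma> A (aut_cocycle (translate z w \<one>\<^bsub>G\<^esub>)) = H2_class \<Gamma> A (aut_cocycle z)"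
proof -
  have mult: "translate (translate z w \<one>\<^bsub>G\<^esub>) v \<one>\<^bsub>G\<^esub> = translate z (\<lambda>\<sigma>\<in>carrier \<Gamma>. v \<sigma> \<otimes>\<^bsub>A\<^esub> w \<sigma>) \<one>\<^bsub>G\<^esub>"
    if "v \<in> Maps (gtop \<Gamma>) A" for v
  proof -
    have "(\<lambda>\<sigma>\<in>carrier \<Gamma>. \<theta> \<one>\<^bsub>G\<^esub> (v \<sigma>) \<otimes>\<^bsub>A\<^esub> w \<sigma>) = (\<lambda>\<sigma>\<in>carrier \<Gamma>. v \<sigma> \<otimes>\<^bsub>A\<^esub> w \<sigma>)"
      using that by (intro restrict_ext) simp
    then show ?thesis using that by (simp add: cm_act_cm_act[OF z w])
  qed
  show ?thesis
    unfolding H2_class_aut_cocycle[OF z]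
      H2_class_aut_cocycle[OF cm_act_mem_Z1_cm[OF z w G.B.one_closed]]
  proof (intro subset_antisym image_subsetI)
    fix v assume v: "v \<in> Maps (gtop \<Gamma>) A"
    have "(\<lambda>\<sigma>\<in>carrier \<Gamma>. v \<sigma> \<otimes>\<^bsub>A\<^esub> w \<sigma>) \<in> Maps (gtop \<Gamma>) A"
      using v w by (intro restrict_mem_Maps_gtop continuous_cochain_intros MapsD(1))
    then show "aut_cocycle (translate (translate z w \<one>\<^bsub>G\<^esub>) v \<one>\<^bsub>G\<^esub>)
        \<in> (\<lambda>w. aut_cocycle (translate z w \<one>\<^bsub>G\<^esub>)) ` Maps (gtop \<Gamma>) A"
      using mult[OF v] by simp
    define x where "x = (\<lambda>\<sigma>\<in>carrier \<Gamma>. v \<sigma> \<otimes>\<^bsub>A\<^esub> inv\<^bsub>A\<^esub> (w \<sigma>))"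
    have x: "x \<in> Maps (gtop \<Gamma>) A"
      unfolding x_def using v w by (intro restrict_mem_Maps_gtop continuous_cochain_intros MapsD(1))
    have "(\<lambda>\<sigma>\<in>carrier \<Gamma>. x \<sigma> \<otimes>\<^bsub>A\<^esub> w \<sigma>) = restrict v (carrier \<Gamma>)"
      unfolding x_def using v w by (intro restrict_ext) (simp add: A.B.m_assoc)
    then have "translate z v \<one>\<^bsub>G\<^esub> = translate (translate z w \<one>\<^bsub>G\<^esub>) x \<one>\<^bsub>G\<^esub>"
      using mult[OF x] v by simp
    then show "aut_cocycle (translate z v \<one>\<^bsub>G\<^esub>)
        \<in> (\<lambda>v. aut_cocycle (translate (translate z w \<one>\<^bsub>G\<^esub>) v \<one>\<^bsub>G\<^esub>)) ` Maps (gtop \<Gamma>) A"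
      using x by simp
  qed
qed

text \<open>
  Normality lets \<open>(w, g)\<close> be written as \<open>(1, g) (v, 1)\<close> with \<open>v = \<theta> (g\<^sup>-\<^sup>1) \<circ> w\<close>, and the factor \<open>(v, 1)\<close> is absorbed
  by the class.
\<close>

lemma H2_class_translate:
  assumes z: "z \<in> Z1_cm \<Gamma> A G \<rho> \<theta>" and w: "w \<in> Maps (gtop \<Gamma>) A" and g: "g \<in> carrier G"
  shows "H2_class \<Gamma> A (aut_cocycle (translate z w g)) = H2_class \<Gamma> A (aut_cocycle (translate z one1 g))"
proof -
  define v where "v = (\<lambda>\<sigma>\<in>carrier \<Gamma>. \<theta> (inv\<^bsub>G\<^esub> g) (w \<sigma>))"
  have v: "v \<in> Maps (gtop \<Gamma>) A"
    unfolding v_def using w g by (intro restrict_mem_Maps_gtop continuous_cochain_intros MapsD(1)) auto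
  have "(\<lambda>\<sigma>\<in>carrier \<Gamma>. \<theta> g (v \<sigma>)) = restrict w (carrier \<Gamma>)"
    unfolding v_def using w g by (intro restrict_ext) simp
  then have "translate (translate z one1 g) v \<one>\<^bsub>G\<^esub> = translate z w g"
    using translate_factor(2)[OF z v g] w by simp
  then show ?thesis
    using H2_class_translate_Maps[OF cm_act_mem_Z1_cm[OF z one1_mem_Maps g] v] by simp
qed

text \<open>
  Another representative of the class of \<open>D z\<close> is \<open>D (z * (w, 1))\<close>, and its conjugate is
  \<open>D (z * (w, g))\<close>, whose class does not depend on \<open>w\<close>.
\<close>

lemma conj_class_Delta:
  assumes z: "z \<in> Z1_cm \<Gamma> A G \<rho> \<theta>" and g: "g \<in> carrier G"
  shows "conj_class \<Gamma> A G \<theta> g (Delta \<Gamma> A \<theta> z) = Delta \<Gamma> A \<theta> (translate z one1 g)"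
proof -
  have "H2_class \<Gamma> A (conj_cocycle \<Gamma> A G \<theta> g (aut_cocycle (translate z w \<one>\<^bsub>G\<^esub>))) =
      H2_class \<Gamma> A (aut_cocycle (translate z one1 g))" if w: "w \<in> Maps (gtop \<Gamma>) A" for w
    unfolding conj_aut_cocycle[OF cm_act_mem_Z1_cm[OF z w G.B.one_closed] g]
      translate_factor(1)[OF z w g] by (rule H2_class_translate[OF z w g])
  then show ?thesis
    unfolding conj_class_def Delta_eq H2_class_aut_cocycle[OF z] image_image
    by (rule the_elem_image_const[OF one1_mem_Maps])
qed

text \<open>
  The group \<open>Maps(\<Gamma>, A) \<times> G\<close> is the product of its two factors, and the orbits of both on the side of
  \<open>H\<^sup>2\<close> are known. The right-hand side mentions \<open>z\<close> only through its class, so \<open>\<Delta>\<close> is well defined.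
\<close>

lemma G_orbit_Delta:
  assumes z: "z \<in> Z1_cm \<Gamma> A G \<rho> \<theta>"
  shows "G_orbit \<Gamma> A G \<theta> (Delta \<Gamma> A \<theta> z) = Delta \<Gamma> A \<theta> ` H1_cm_class \<Gamma> A G \<rho> \<theta> z"
proof -
  have shift: "Delta \<Gamma> A \<theta> (translate z one1 g) = Delta \<Gamma> A \<theta> (translate z w g)"
    if "w \<in> Maps (gtop \<Gamma>) A" "g \<in> carrier G" for w g
    unfolding Delta_eq by (rule H2_class_translate[OF z that, symmetric])
  have "G_orbit \<Gamma> A G \<theta> (Delta \<Gamma> A \<theta> z) = (\<lambda>g. Delta \<Gamma> A \<theta> (translate z one1 g)) ` carrier G"
    unfolding G_orbit_def using conj_class_Delta[OF z] by (rule image_cong[OF refl])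
  also have "\<dots> = (\<lambda>(w, g). Delta \<Gamma> A \<theta> (translate z w g)) ` (Maps (gtop \<Gamma>) A \<times> carrier G)"
  proof (intro subset_antisym image_subsetI)
    fix g assume "g \<in> carrier G"
    then have "(one1, g) \<in> Maps (gtop \<Gamma>) A \<times> carrier G" using one1_mem_Maps by simp
    then show "Delta \<Gamma> A \<theta> (translate z one1 g) \<in>
        (\<lambda>(w, g). Delta \<Gamma> A \<theta> (translate z w g)) ` (Maps (gtop \<Gamma>) A \<times> carrier G)"
      by (rule rev_image_eqI) simp
  next
    fix p assume "p \<in> Maps (gtop \<Gamma>) A \<times> carrier G"
    then obtain w g where p: "p = (w, g)" and k: "w \<in> Maps (gtop \<Gamma>) A" "g \<in> carrier G" by auto
    show "(case p of (w, g) \<Rightarrow> Delta \<Gamma> A \<theta> (translate z w g)) \<in>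
        (\<lambda>g. Delta \<Gamma> A \<theta> (translate z one1 g)) ` carrier G"
      unfolding p prod.case shift[OF k, symmetric] using k(2) by (rule imageI)
  qed
  also have "\<dots> = Delta \<Gamma> A \<theta> ` H1_cm_class \<Gamma> A G \<rho> \<theta> z"
    by (simp add: H1_cm_class_def image_image case_prod_unfold)
  finally show ?thesis .
qed

lemma H1_cm_class_subset:
  "z \<in> Z1_cm \<Gamma> A G \<rho> \<theta> \<Longrightarrow> H1_cm_class \<Gamma> A G \<rho> \<theta> z \<subseteq> Z1_cm \<Gamma> A G \<rho> \<theta>"
  unfolding H1_cm_class_def using cm_act_mem_Z1_cm by blast

lemma Delta_rel_class:
  assumes z: "z \<in> Z1_cm \<Gamma> A G \<rho> \<theta>"
  shows "Delta_rel \<Gamma> A G \<theta> (H1_cm_class \<Gamma> A G \<rho> \<theta> z) = G_orbit \<Gamma> A G \<theta> (Delta \<Gamma> A \<theta> z)"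
proof -
  have "G_orbit \<Gamma> A G \<theta> (Delta \<Gamma> A \<theta> y) = G_orbit \<Gamma> A G \<theta> (Delta \<Gamma> A \<theta> z)"
    if "y \<in> H1_cm_class \<Gamma> A G \<rho> \<theta> z" for y
  proof -
    have y: "y \<in> Z1_cm \<Gamma> A G \<rho> \<theta>" using that H1_cm_class_subset[OF z] by blast
    show ?thesis unfolding G_orbit_Delta[OF z] G_orbit_Delta[OF y] H1_cm_class_eq[OF z that] ..
  qed
  then show ?thesis
    unfolding Delta_rel_def by (rule the_elem_image_const[OF H1_cm_class_refl[OF z]])
qed

section \<open>Bands\<close>

definition band :: "('s \<Rightarrow> 'g) \<Rightarrow> 's \<Rightarrow> ('a \<Rightarrow> 'a) set" where
  "band \<psi> = (\<lambda>\<sigma>\<in>carrier \<Gamma>. mod_Inn A (aut_part \<Gamma> A \<theta> \<psi> \<sigma>))"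

lemma mod_Inn_inn_mult:
  assumes "a \<in> carrier A" "f \<in> auto A"
  shows "mod_Inn A (inn A a \<otimes>\<^bsub>AutoGroup A\<^esub> f) = mod_Inn A f"
proof -
  have sub: "subgroup (Inn A) (AutoGroup A)"
    using normal_Inn[OF A.B.is_group] by (rule normal_imp_subgroup)
  have "inn A a \<in> Inn A" using assms(1) by (simp add: Inn_def)
  moreover have "Inn A \<subseteq> carrier (AutoGroup A)" using subgroup.subset[OF sub] .
  ultimately show ?thesis
    using assms Aut.coset_mult_assoc[of "Inn A" "inn A a" f] Aut.coset_join2[OF _ sub, of "inn A a"]
    by (simp add: mod_Inn_def)
qed

lemma mod_Inn_closed: "f \<in> auto A \<Longrightarrow> mod_Inn A f \<in> carrier (Out A)"
  by (auto simp: Out_def mod_Inn_def carrier_FactGroup)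

lemma mod_Inn_mult:
  assumes "f \<in> auto A" "h \<in> auto A"
  shows "mod_Inn A f \<otimes>\<^bsub>Out A\<^esub> mod_Inn A h = mod_Inn A (f \<otimes>\<^bsub>AutoGroup A\<^esub> h)"
  using normal.rcos_sum[OF normal_Inn[OF A.B.is_group], of f h] assms
  by (simp add: Out_def mod_Inn_def FactGroup_def)

lemma aut_part_mult:
  assumes z: "(u, \<psi>) \<in> Z1_cm \<Gamma> A G \<rho> \<theta>" and s: "\<sigma> \<in> carrier \<Gamma>" "\<tau> \<in> carrier \<Gamma>"
  shows "inn A (u (\<sigma>, \<tau>)) \<otimes>\<^bsub>AutoGroup A\<^esub> aut_part \<Gamma> A \<theta> \<psi> \<sigma> \<otimes>\<^bsub>AutoGroup A\<^esub> aut_part \<Gamma> A \<theta> \<psi> \<tau> =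
    aut_part \<Gamma> A \<theta> \<psi> (\<sigma> \<otimes>\<^bsub>\<Gamma>\<^esub> \<tau>)"
  by (rule auto_eqI) (use Z1_cmD[OF z] s in simp_all)

text \<open>
  Local constancy of the automorphism part and of the band is measured relative to the action of \<open>\<Gamma>\<close>. The quotient by
  that action is \<open>\<theta> \<circ> \<psi>\<close>, which is locally constant because \<open>\<psi>\<close> is.
\<close>

lemma aut_part_quotient:
  assumes "\<psi> \<in> Maps (gtop \<Gamma>) G" "\<sigma> \<in> carrier \<Gamma>"
  shows "aut_part \<Gamma> A \<theta> \<psi> \<sigma> \<otimes>\<^bsub>AutoGroup A\<^esub> inv\<^bsub>AutoGroup A\<^esub> (gact A \<sigma>) = \<theta> (\<psi> \<sigma>)"
  using assms by (simp add: aut_part_def Aut.m_assoc)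

text \<open>
  Modulo inner automorphisms the factor \<open>inn (u (\<sigma>, \<tau>))\<close> in \<open>aut_part_mult\<close> disappears, which leaves a
  homomorphism.
\<close>

lemma band_mem_Phi:
  assumes z: "(u, \<psi>) \<in> Z1_cm \<Gamma> A G \<rho> \<theta>"
  shows "band \<psi> \<in> Phi \<Gamma> A G \<rho> \<theta>"
proof -
  note zD = Z1_cmD[OF z]
  interpret Out: group "Out A"
    unfolding Out_def by (rule normal.factorgroup_is_group[OF normal_Inn[OF A.B.is_group]])
  have q: "group_hom (AutoGroup A) (Out A) (mod_Inn A)"
    by unfold_locales (auto simp: hom_def mod_Inn_closed mod_Inn_mult)
  have "band \<psi> \<in> hom \<Gamma> (Out A)"
  proof (rule homI)
    fix \<sigma> \<tau> assume s: "\<sigma> \<in> carrier \<Gamma>" "\<tau> \<in> carrier \<Gamma>"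
    then show "band \<psi> \<sigma> \<in> carrier (Out A)" using zD by (simp add: band_def mod_Inn_closed)
    have "mod_Inn A (aut_part \<Gamma> A \<theta> \<psi> (\<sigma> \<otimes>\<^bsub>\<Gamma>\<^esub> \<tau>)) =
        mod_Inn A (aut_part \<Gamma> A \<theta> \<psi> \<sigma> \<otimes>\<^bsub>AutoGroup A\<^esub> aut_part \<Gamma> A \<theta> \<psi> \<tau>)"
      unfolding aut_part_mult[OF z s, symmetric]
      using zD(1,2) s by (simp add: Aut.m_assoc mod_Inn_inn_mult)
    then show "band \<psi> (\<sigma> \<otimes>\<^bsub>\<Gamma>\<^esub> \<tau>) = band \<psi> \<sigma> \<otimes>\<^bsub>Out A\<^esub> band \<psi> \<tau>"
      using zD(2) s by (simp add: band_def mod_Inn_mult)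
  qed
  moreover have "continuous_map (gtop \<Gamma>) (discrete_topology (carrier (Out A)))
      (\<lambda>\<sigma>. band \<psi> \<sigma> \<otimes>\<^bsub>Out A\<^esub> inv\<^bsub>Out A\<^esub> (mod_Inn A (gact A \<sigma>)))"
  proof (rule continuous_map_eq)
    show "continuous_map (gtop \<Gamma>) (discrete_topology (carrier (Out A))) (\<lambda>\<sigma>. mod_Inn A (\<theta> (\<psi> \<sigma>)))"
      by (rule continuous_map_discrete_map2[OF MapsD(1)[OF zD(2)] MapsD(1)[OF zD(2)],
            where h = "\<lambda>s t. mod_Inn A (\<theta> s)"]) (simp add: mod_Inn_closed)
    fix \<sigma> assume "\<sigma> \<in> topspace (gtop \<Gamma>)"
    then have s: "\<sigma> \<in> carrier \<Gamma>" by (simp add: \<Gamma>.topspace_gtop)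
    then have "inv\<^bsub>AutoGroup A\<^esub> gact A \<sigma> \<in> auto A" using Aut.inv_closed[of "gact A \<sigma>"] by simp
    then show "mod_Inn A (\<theta> (\<psi> \<sigma>)) =
        band \<psi> \<sigma> \<otimes>\<^bsub>Out A\<^esub> inv\<^bsub>Out A\<^esub> (mod_Inn A (gact A \<sigma>))"
      using zD(2) s aut_part_quotient[OF zD(2) s] group_hom.hom_inv[OF q, of "gact A \<sigma>"]
      by (simp add: band_def mod_Inn_mult flip: group_hom.hom_inv[OF q])
  qed
  moreover have "band \<psi> \<in> carrier \<Gamma> \<rightarrow>\<^sub>E carrier (Out A)"
    using zD by (auto simp: band_def mod_Inn_closed)
  ultimately have "band \<psi> \<in> bands \<Gamma> A"
    by (simp add: bands_def rel_Maps_def \<Gamma>.topspace_gtop)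
  then show ?thesis using z by (auto simp: Phi_def band_def)
qed

lemma aut_cocycle_mem_Z2:
  assumes z: "(u, \<psi>) \<in> Z1_cm \<Gamma> A G \<rho> \<theta>"
  shows "aut_cocycle (u, \<psi>) \<in> Z2 \<Gamma> A (band \<psi>)"
proof -
  note zD = Z1_cmD[OF z]
  have "continuous_map (gtop \<Gamma>) (discrete_topology (carrier (AutoGroup A))) (\<lambda>\<sigma>. \<theta> (\<psi> \<sigma>))"
    by (rule continuous_map_discrete_map2[OF MapsD(1)[OF zD(2)] MapsD(1)[OF zD(2)],
          where h = "\<lambda>s t. \<theta> s"]) simp
  then have "continuous_map (gtop \<Gamma>) (discrete_topology (carrier (AutoGroup A)))
      (\<lambda>\<sigma>. aut_part \<Gamma> A \<theta> \<psi> \<sigma> \<otimes>\<^bsub>AutoGroup A\<^esub> inv\<^bsub>AutoGroup A\<^esub> (gact A \<sigma>))"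
    by (rule continuous_map_eq) (simp add: aut_part_quotient[OF zD(2)] \<Gamma>.topspace_gtop)
  moreover have "aut_part \<Gamma> A \<theta> \<psi> \<in> carrier \<Gamma> \<rightarrow>\<^sub>E auto A"
    using zD(2) by (auto simp: aut_part_def)
  ultimately have "aut_part \<Gamma> A \<theta> \<psi> \<in> aut_cochains \<Gamma> A"
    by (simp add: aut_cochains_def rel_Maps_def \<Gamma>.topspace_gtop)
  moreover have "u (\<sigma>, \<tau> \<otimes>\<^bsub>\<Gamma>\<^esub> \<upsilon>) \<otimes>\<^bsub>A\<^esub> aut_part \<Gamma> A \<theta> \<psi> \<sigma> (u (\<tau>, \<upsilon>)) = u (\<sigma> \<otimes>\<^bsub>\<Gamma>\<^esub> \<tau>, \<upsilon>) \<otimes>\<^bsub>A\<^esub> u (\<sigma>, \<tau>)"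
    if "\<sigma> \<in> carrier \<Gamma>" "\<tau> \<in> carrier \<Gamma>" "\<upsilon> \<in> carrier \<Gamma>" for \<sigma> \<tau> \<upsilon>
    using that zD(1,2) by (simp add: zD(4) A.B.m_assoc)
  ultimately show ?thesis
    using zD(1) aut_part_mult[OF z] by (simp add: Z2_def aut_cocycle_def band_def)
qed

lemma Delta_mem_H2:
  "(u, \<psi>) \<in> Z1_cm \<Gamma> A G \<rho> \<theta> \<Longrightarrow> Delta \<Gamma> A \<theta> (u, \<psi>) \<in> H2 \<Gamma> A (band \<psi>)"
  unfolding Delta_eq H2_def using aut_cocycle_mem_Z2 by simp

lemma G_orbit_mem_H2_rel:
  assumes z: "z \<in> Z1_cm \<Gamma> A G \<rho> \<theta>"
  shows "G_orbit \<Gamma> A G \<theta> (Delta \<Gamma> A \<theta> z) \<in> H2_rel \<Gamma> A G \<rho> \<theta>"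
proof -
  obtain u \<psi> where z_eq: "z = (u, \<psi>)" by (cases z)
  have "Delta \<Gamma> A \<theta> z \<in> H2_Phi \<Gamma> A G \<rho> \<theta>"
    unfolding H2_Phi_def using Delta_mem_H2 band_mem_Phi z z_eq by blast
  then show ?thesis unfolding H2_rel_def by simp
qed

section \<open>Neutral orbits and classes from the group\<close>

lemma neutral_Delta_iff:
  assumes z: "z \<in> Z1_cm \<Gamma> A G \<rho> \<theta>"
  shows "neutral_class \<Gamma> A (Delta \<Gamma> A \<theta> z) \<longleftrightarrow> (\<exists>w\<in>Maps (gtop \<Gamma>) A. fst (translate z w \<one>\<^bsub>G\<^esub>) = one2 \<Gamma> A)"
  unfolding neutral_class_def Delta_eq H2_class_aut_cocycle[OF z]
  by (force simp: aut_cocycle_def case_prod_unfold)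

text \<open>
  A neutral member of the orbit is the class of \<open>D y\<close> for some \<open>y\<close> in the class of \<open>z\<close>, and a
  representative \<open>(1, f)\<close> of this member comes from some \<open>y * (w, 1)\<close>, which is again in the class of \<open>z\<close>.
\<close>

lemma G_orbit_neutral_iff:
  assumes z: "z \<in> Z1_cm \<Gamma> A G \<rho> \<theta>"
  shows "G_orbit \<Gamma> A G \<theta> (Delta \<Gamma> A \<theta> z) \<in> neutral_elements \<Gamma> A G \<rho> \<theta> \<longleftrightarrow>
    (\<exists>\<psi>. (one2 \<Gamma> A, \<psi>) \<in> H1_cm_class \<Gamma> A G \<rho> \<theta> z)"
proof
  assume "G_orbit \<Gamma> A G \<theta> (Delta \<Gamma> A \<theta> z) \<in> neutral_elements \<Gamma> A G \<rho> \<theta>"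
  then obtain y where y: "y \<in> H1_cm_class \<Gamma> A G \<rho> \<theta> z" and "neutral_class \<Gamma> A (Delta \<Gamma> A \<theta> y)"
    unfolding neutral_elements_def G_orbit_Delta[OF z] by auto
  moreover have "y \<in> Z1_cm \<Gamma> A G \<rho> \<theta>" using y H1_cm_class_subset[OF z] by auto
  ultimately obtain w where w: "w \<in> Maps (gtop \<Gamma>) A" "fst (translate y w \<one>\<^bsub>G\<^esub>) = one2 \<Gamma> A"
    using neutral_Delta_iff by auto
  have "translate y w \<one>\<^bsub>G\<^esub> \<in> H1_cm_class \<Gamma> A G \<rho> \<theta> y"
    unfolding H1_cm_class_def using w(1) by simp
  then have "(one2 \<Gamma> A, snd (translate y w \<one>\<^bsub>G\<^esub>)) \<in> H1_cm_class \<Gamma> A G \<rho> \<theta> z"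
    unfolding w(2)[symmetric] H1_cm_class_eq[OF z y] by simp
  then show "\<exists>\<psi>. (one2 \<Gamma> A, \<psi>) \<in> H1_cm_class \<Gamma> A G \<rho> \<theta> z" by blast
next
  assume "\<exists>\<psi>. (one2 \<Gamma> A, \<psi>) \<in> H1_cm_class \<Gamma> A G \<rho> \<theta> z"
  then obtain \<psi> where y: "(one2 \<Gamma> A, \<psi>) \<in> H1_cm_class \<Gamma> A G \<rho> \<theta> z" ..
  have yZ: "(one2 \<Gamma> A, \<psi>) \<in> Z1_cm \<Gamma> A G \<rho> \<theta>" using y H1_cm_class_subset[OF z] by auto
  have "neutral_class \<Gamma> A (Delta \<Gamma> A \<theta> (one2 \<Gamma> A, \<psi>))"
    unfolding neutral_Delta_iff[OF yZ] using one1_mem_Maps cm_act_one[OF yZ] by (metis fst_conv)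
  moreover have "Delta \<Gamma> A \<theta> (one2 \<Gamma> A, \<psi>) \<in> G_orbit \<Gamma> A G \<theta> (Delta \<Gamma> A \<theta> z)"
    unfolding G_orbit_Delta[OF z] using y by (rule imageI)
  ultimately show "G_orbit \<Gamma> A G \<theta> (Delta \<Gamma> A \<theta> z) \<in> neutral_elements \<Gamma> A G \<rho> \<theta>"
    unfolding neutral_elements_def
    using G_orbit_mem_H2_rel[OF z] band_mem_Phi[OF yZ] Delta_mem_H2[OF yZ] by blast
qed

lemma one2_mem_Z1_cm_iff: "(one2 \<Gamma> A, c) \<in> Z1_cm \<Gamma> A G \<rho> \<theta> \<longleftrightarrow> c \<in> Z1 \<Gamma> G"
proof -
  have "c \<in> Maps (gtop \<Gamma>) G \<Longrightarrow> ?thesis"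
    using one2_mem_Maps by (auto simp: Z1_cm_def Z1_def)
  then show ?thesis by (auto simp: Z1_cm_def Z1_def)
qed

lemma cm_act_one2:
  assumes "c \<in> Maps (gtop \<Gamma>) G" "g \<in> carrier G"
  shows "translate (one2 \<Gamma> A, c) one1 g =
    (one2 \<Gamma> A, \<lambda>\<sigma>\<in>carrier \<Gamma>. inv\<^bsub>G\<^esub> g \<otimes>\<^bsub>G\<^esub> c \<sigma> \<otimes>\<^bsub>G\<^esub> gact G \<sigma> g)"
  using assms by (auto simp: cm_act_def intro!: restrict_ext)

text \<open>
  If \<open>g\<close> relates the cocycles \<open>c\<close> and \<open>d\<close>, then \<open>(1, g)\<close> relates the pairs \<open>(1, c)\<close> and \<open>(1, d)\<close>.
\<close>

lemma i_star_H1_class: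
  assumes c: "c \<in> Z1 \<Gamma> G"
  shows "i_star \<Gamma> A G \<rho> \<theta> (H1_class \<Gamma> G c) = H1_cm_class \<Gamma> A G \<rho> \<theta> (one2 \<Gamma> A, c)"
proof -
  have z: "(one2 \<Gamma> A, c) \<in> Z1_cm \<Gamma> A G \<rho> \<theta>" using c by (simp add: one2_mem_Z1_cm_iff)
  have "H1_cm_class \<Gamma> A G \<rho> \<theta> (one2 \<Gamma> A, d) = H1_cm_class \<Gamma> A G \<rho> \<theta> (one2 \<Gamma> A, c)"
    if d: "d \<in> H1_class \<Gamma> G c" for d
  proof -
    obtain g where g: "g \<in> carrier G"
      and d_eq: "d = (\<lambda>\<sigma>\<in>carrier \<Gamma>. inv\<^bsub>G\<^esub> g \<otimes>\<^bsub>G\<^esub> c \<sigma> \<otimes>\<^bsub>G\<^esub> gact G \<sigma> g)"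
      using d unfolding H1_class_def by auto
    have "translate (one2 \<Gamma> A, c) one1 g \<in> H1_cm_class \<Gamma> A G \<rho> \<theta> (one2 \<Gamma> A, c)"
      unfolding H1_cm_class_def using g one1_mem_Maps by simp
    then show ?thesis
      using H1_cm_class_eq[OF z] cm_act_one2[OF G.Z1D(1)[OF c] g] d_eq by simp
  qed
  then show ?thesis
    unfolding i_star_def by (rule the_elem_image_const[OF G.H1_class_refl[OF c]])
qed

lemma mem_image_i_star_iff:
  assumes z: "z \<in> Z1_cm \<Gamma> A G \<rho> \<theta>"
  shows "H1_cm_class \<Gamma> A G \<rho> \<theta> z \<in> i_star \<Gamma> A G \<rho> \<theta> ` H1 \<Gamma> G \<longleftrightarrow>
    (\<exists>\<psi>. (one2 \<Gamma> A, \<psi>) \<in> H1_cm_class \<Gamma> A G \<rho> \<theta> z)"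
proof
  assume "H1_cm_class \<Gamma> A G \<rho> \<theta> z \<in> i_star \<Gamma> A G \<rho> \<theta> ` H1 \<Gamma> G"
  then obtain c where c: "c \<in> Z1 \<Gamma> G"
    and "H1_cm_class \<Gamma> A G \<rho> \<theta> z = H1_cm_class \<Gamma> A G \<rho> \<theta> (one2 \<Gamma> A, c)"
    by (auto simp: H1_def i_star_H1_class)
  then show "\<exists>\<psi>. (one2 \<Gamma> A, \<psi>) \<in> H1_cm_class \<Gamma> A G \<rho> \<theta> z"
    using H1_cm_class_refl one2_mem_Z1_cm_iff by metis
next
  assume "\<exists>\<psi>. (one2 \<Gamma> A, \<psi>) \<in> H1_cm_class \<Gamma> A G \<rho> \<theta> z"
  then obtain \<psi> where y: "(one2 \<Gamma> A, \<psi>) \<in> H1_cm_class \<Gamma> A G \<rho> \<theta> z" ..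
  then have "\<psi> \<in> Z1 \<Gamma> G" using H1_cm_class_subset[OF z] one2_mem_Z1_cm_iff by auto
  then show "H1_cm_class \<Gamma> A G \<rho> \<theta> z \<in> i_star \<Gamma> A G \<rho> \<theta> ` H1 \<Gamma> G"
    using H1_cm_class_eq[OF z y] i_star_H1_class[of \<psi>] by (auto simp: H1_def intro!: image_eqI)
qed

section \<open>Exactness at the cohomology of the group\<close>

lemma rho_Z1:
  assumes c: "c \<in> Z1 \<Gamma> A"
  shows "(\<lambda>\<sigma>\<in>carrier \<Gamma>. \<rho> (c \<sigma>)) \<in> Z1 \<Gamma> G"
proof -
  note cD = A.Z1D[OF c]
  have "(\<lambda>\<sigma>\<in>carrier \<Gamma>. \<rho> (c \<sigma>)) \<in> Maps (gtop \<Gamma>) G"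
    using MapsD(1)[OF cD(1)] by (intro restrict_mem_Maps continuous_rho) (auto simp: \<Gamma>.topspace_gtop)
  then show ?thesis using cD by (simp add: Z1_def)
qed

lemma rho_star_H1_class:
  assumes c: "c \<in> Z1 \<Gamma> A"
  shows "rho_star \<Gamma> A G \<rho> (H1_class \<Gamma> A c) = H1_class \<Gamma> G (\<lambda>\<sigma>\<in>carrier \<Gamma>. \<rho> (c \<sigma>))"
proof -
  have "H1_class \<Gamma> G (\<lambda>\<sigma>\<in>carrier \<Gamma>. \<rho> (d \<sigma>)) = H1_class \<Gamma> G (\<lambda>\<sigma>\<in>carrier \<Gamma>. \<rho> (c \<sigma>))"
    if d: "d \<in> H1_class \<Gamma> A c" for d
  proof -
    obtain a where a: "a \<in> carrier A"
      and d_eq: "d = (\<lambda>\<sigma>\<in>carrier \<Gamma>. inv\<^bsub>A\<^esub> a \<otimes>\<^bsub>A\<^esub> c \<sigma> \<otimes>\<^bsub>A\<^esub> gact A \<sigma> a)"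
      using d unfolding H1_class_def by auto
    have "(\<lambda>\<sigma>\<in>carrier \<Gamma>. \<rho> (d \<sigma>)) =
        (\<lambda>\<sigma>\<in>carrier \<Gamma>. inv\<^bsub>G\<^esub> (\<rho> a) \<otimes>\<^bsub>G\<^esub> (\<lambda>\<sigma>\<in>carrier \<Gamma>. \<rho> (c \<sigma>)) \<sigma> \<otimes>\<^bsub>G\<^esub> gact G \<sigma> (\<rho> a))"
      using a A.Z1D(1)[OF c] by (intro restrict_ext) (simp add: d_eq)
    then have "(\<lambda>\<sigma>\<in>carrier \<Gamma>. \<rho> (d \<sigma>)) \<in> H1_class \<Gamma> G (\<lambda>\<sigma>\<in>carrier \<Gamma>. \<rho> (c \<sigma>))"
      unfolding H1_class_def using a by (intro image_eqI[of _ _ "\<rho> a"]) auto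
    then show ?thesis using G.H1_class_eq[OF G.Z1D(1)[OF rho_Z1[OF c]]] by simp
  qed
  then show ?thesis
    unfolding rho_star_def by (rule the_elem_image_const[OF A.H1_class_refl[OF c]])
qed

lemma base_mem_Z1_cm: "(one2 \<Gamma> A, \<lambda>_\<in>carrier \<Gamma>. \<one>\<^bsub>G\<^esub>) \<in> Z1_cm \<Gamma> A G \<rho> \<theta>"
proof -
  have "(\<lambda>_\<in>carrier \<Gamma>. \<one>\<^bsub>G\<^esub>) \<in> Maps (gtop \<Gamma>) G"
    by (rule restrict_mem_Maps) (simp_all add: \<Gamma>.topspace_gtop)
  then show ?thesis by (simp add: one2_mem_Z1_cm_iff Z1_def)
qed

text \<open>
  The equation \<open>(1, d) = (1, 1) * (\<phi>, g)\<close> is read componentwise: its first component says that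
  \<open>\<phi>\<close> is a cocycle, and its second component that \<open>g\<close> relates \<open>d\<close> to \<open>\<rho> \<circ> \<phi>\<close>. Conversely a
  cocycle \<open>c\<close> is used as \<open>\<phi>\<close>, with \<open>g = 1\<close>.
\<close>

lemma i_star_base_iff:
  assumes d: "d \<in> Z1 \<Gamma> G"
  shows "i_star \<Gamma> A G \<rho> \<theta> (H1_class \<Gamma> G d) = H1_cm_base \<Gamma> A G \<rho> \<theta> \<longleftrightarrow>
    H1_class \<Gamma> G d \<in> rho_star \<Gamma> A G \<rho> ` H1 \<Gamma> A"
proof
  assume "i_star \<Gamma> A G \<rho> \<theta> (H1_class \<Gamma> G d) = H1_cm_base \<Gamma> A G \<rho> \<theta>"
  then have "(one2 \<Gamma> A, d) \<in> H1_cm_class \<Gamma> A G \<rho> \<theta> (one2 \<Gamma> A, \<lambda>_\<in>carrier \<Gamma>. \<one>\<^bsub>G\<^esub>)"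
    using H1_cm_class_refl[of "(one2 \<Gamma> A, d)"] d
    by (simp add: one2_mem_Z1_cm_iff i_star_H1_class[OF d] H1_cm_base_def)
  then obtain \<phi> g where phi: "\<phi> \<in> Maps (gtop \<Gamma>) A" and g: "g \<in> carrier G"
    and eq: "(one2 \<Gamma> A, d) = translate (one2 \<Gamma> A, \<lambda>_\<in>carrier \<Gamma>. \<one>\<^bsub>G\<^esub>) \<phi> g"
    unfolding H1_cm_class_def by auto
  have "\<phi> (\<sigma> \<otimes>\<^bsub>\<Gamma>\<^esub> \<tau>) = \<phi> \<sigma> \<otimes>\<^bsub>A\<^esub> gact A \<sigma> (\<phi> \<tau>)" if s: "\<sigma> \<in> carrier \<Gamma>" "\<tau> \<in> carrier \<Gamma>" for \<sigma> \<tau>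
  proof -
    define x where "x = \<phi> (\<sigma> \<otimes>\<^bsub>\<Gamma>\<^esub> \<tau>) \<otimes>\<^bsub>A\<^esub> inv\<^bsub>A\<^esub> (\<phi> \<sigma> \<otimes>\<^bsub>A\<^esub> gact A \<sigma> (\<phi> \<tau>))"
    have x: "x \<in> carrier A" unfolding x_def using s phi by simp
    have "\<one>\<^bsub>A\<^esub> = fst (one2 \<Gamma> A, d) (\<sigma>, \<tau>)" using s by simp
    also have "\<dots> = \<theta> (inv\<^bsub>G\<^esub> g) x"
      unfolding eq x_def using s phi g
      by (simp add: cm_act_def A.B.inv_mult_group A.B.m_assoc)
    finally have "\<theta> (inv\<^bsub>G\<^esub> g) x = \<one>\<^bsub>A\<^esub>" ..
    then have "x = \<one>\<^bsub>A\<^esub>" using theta_inv_theta(2)[OF g x] g by (metis theta_one)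
    then show ?thesis using s phi A.B.inv_equality x_def
      by (metis A.B.inv_closed A.B.inv_inv A.B.m_closed A.Maps_closed A.act_closed \<Gamma>.m_closed)
  qed
  then have c: "\<phi> \<in> Z1 \<Gamma> A" using phi by (simp add: Z1_def)
  have "d = snd (one2 \<Gamma> A, d)" by simp
  also have "\<dots> = (\<lambda>\<sigma>\<in>carrier \<Gamma>. inv\<^bsub>G\<^esub> g \<otimes>\<^bsub>G\<^esub> (\<lambda>\<sigma>\<in>carrier \<Gamma>. \<rho> (\<phi> \<sigma>)) \<sigma> \<otimes>\<^bsub>G\<^esub> gact G \<sigma> g)"
    unfolding eq using phi g by (auto simp: cm_act_def intro!: restrict_ext)
  finally have "d \<in> H1_class \<Gamma> G (\<lambda>\<sigma>\<in>carrier \<Gamma>. \<rho> (\<phi> \<sigma>))"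
    unfolding H1_class_def using g by (intro image_eqI[of _ _ g]) auto
  then have "H1_class \<Gamma> G d = rho_star \<Gamma> A G \<rho> (H1_class \<Gamma> A \<phi>)"
    using G.H1_class_eq[OF G.Z1D(1)[OF rho_Z1[OF c]]] rho_star_H1_class[OF c] by simp
  then show "H1_class \<Gamma> G d \<in> rho_star \<Gamma> A G \<rho> ` H1 \<Gamma> A" using c by (simp add: H1_def)
next
  assume "H1_class \<Gamma> G d \<in> rho_star \<Gamma> A G \<rho> ` H1 \<Gamma> A"
  then obtain c where c: "c \<in> Z1 \<Gamma> A"
    and eq: "H1_class \<Gamma> G d = H1_class \<Gamma> G (\<lambda>\<sigma>\<in>carrier \<Gamma>. \<rho> (c \<sigma>))"
    by (auto simp: H1_def rho_star_H1_class)
  have "translate (one2 \<Gamma> A, \<lambda>_\<in>carrier \<Gamma>. \<one>\<^bsub>G\<^esub>) c \<one>\<^bsub>G\<^esub> = (one2 \<Gamma> A, \<lambda>\<sigma>\<in>carrier \<Gamma>. \<rho> (c \<sigma>))"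
    using A.Z1D[OF c] by (auto simp: cm_act_def A.B.m_assoc intro!: restrict_ext)
  then have "(one2 \<Gamma> A, \<lambda>\<sigma>\<in>carrier \<Gamma>. \<rho> (c \<sigma>)) \<in>
      H1_cm_class \<Gamma> A G \<rho> \<theta> (one2 \<Gamma> A, \<lambda>_\<in>carrier \<Gamma>. \<one>\<^bsub>G\<^esub>)"
    unfolding H1_cm_class_def using A.Z1D(1)[OF c]
    by (intro image_eqI[of _ _ "(c, \<one>\<^bsub>G\<^esub>)"]) auto
  then show "i_star \<Gamma> A G \<rho> \<theta> (H1_class \<Gamma> G d) = H1_cm_base \<Gamma> A G \<rho> \<theta>"
    unfolding eq i_star_H1_class[OF rho_Z1[OF c]] H1_cm_base_def
    by (rule H1_cm_class_eq[OF base_mem_Z1_cm])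
qed

lemma i_star_image_iff_neutral:
  assumes "z \<in> Z1_cm \<Gamma> A G \<rho> \<theta>"
  shows "H1_cm_class \<Gamma> A G \<rho> \<theta> z \<in> i_star \<Gamma> A G \<rho> \<theta> ` H1 \<Gamma> G \<longleftrightarrow>
    G_orbit \<Gamma> A G \<theta> (Delta \<Gamma> A \<theta> z) \<in> neutral_elements \<Gamma> A G \<rho> \<theta>"
  using assms by (simp only: mem_image_i_star_iff G_orbit_neutral_iff)

section \<open>The exact sequence\<close>

lemma rho_star_maps: "rho_star \<Gamma> A G \<rho> \<in> H1 \<Gamma> A \<rightarrow> H1 \<Gamma> G"
  by (auto simp: H1_def rho_star_H1_class rho_Z1)

lemma i_star_maps: "i_star \<Gamma> A G \<rho> \<theta> \<in> H1 \<Gamma> G \<rightarrow> H1_cm \<Gamma> A G \<rho> \<theta>"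
  by (auto simp: H1_def H1_cm_def i_star_H1_class one2_mem_Z1_cm_iff)

lemma Delta_rel_maps: "Delta_rel \<Gamma> A G \<theta> \<in> H1_cm \<Gamma> A G \<rho> \<theta> \<rightarrow> H2_rel \<Gamma> A G \<rho> \<theta>"
  by (auto simp: H1_cm_def Delta_rel_class G_orbit_mem_H2_rel)

lemma exact_at_H1:
  "rho_star \<Gamma> A G \<rho> ` H1 \<Gamma> A =
    {x \<in> H1 \<Gamma> G. i_star \<Gamma> A G \<rho> \<theta> x = H1_cm_base \<Gamma> A G \<rho> \<theta>}"
proof -
  have "x \<in> rho_star \<Gamma> A G \<rho> ` H1 \<Gamma> A \<longleftrightarrow> i_star \<Gamma> A G \<rho> \<theta> x = H1_cm_base \<Gamma> A G \<rho> \<theta>"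
    if "x \<in> H1 \<Gamma> G" for x
  proof -
    obtain d where d: "d \<in> Z1 \<Gamma> G" and x_eq: "x = H1_class \<Gamma> G d"
      using \<open>x \<in> H1 \<Gamma> G\<close> by (auto simp: H1_def)
    show ?thesis unfolding x_eq by (rule i_star_base_iff[OF d, symmetric])
  qed
  then show ?thesis using rho_star_maps by auto
qed

lemma exact_at_H1_cm:
  "i_star \<Gamma> A G \<rho> \<theta> ` H1 \<Gamma> G =
    {x \<in> H1_cm \<Gamma> A G \<rho> \<theta>. Delta_rel \<Gamma> A G \<theta> x \<in> neutral_elements \<Gamma> A G \<rho> \<theta>}"
proof -
  have "x \<in> i_star \<Gamma> A G \<rho> \<theta> ` H1 \<Gamma> G \<longleftrightarrow> Delta_rel \<Gamma> A G \<theta> x \<in> neutral_elements \<Gamma> A G \<rho> \<theta>"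
    if x: "x \<in> H1_cm \<Gamma> A G \<rho> \<theta>" for x
  proof -
    obtain z where z: "z \<in> Z1_cm \<Gamma> A G \<rho> \<theta>" and x_eq: "x = H1_cm_class \<Gamma> A G \<rho> \<theta> z"
      using x by (auto simp: H1_cm_def)
    show ?thesis
      unfolding x_eq Delta_rel_class[OF z] by (rule i_star_image_iff_neutral[OF z])
  qed
  then show ?thesis using i_star_maps by auto
qed

end

theorem corollary3p12:
  fixes \<Gamma> :: "'s top_group" and A :: "('s, 'a) gamma_group" and G :: "('s, 'g) gamma_group"
    and \<rho> :: "'a \<Rightarrow> 'g" and \<theta> :: "'g \<Rightarrow> 'a \<Rightarrow> 'a"
  assumes "profinite_group \<Gamma>" and "crossed_module \<Gamma> A G \<rho> \<theta>"
  shows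
    "(\<forall>(u, \<psi>)\<in>Z1_cm \<Gamma> A G \<rho> \<theta>.
        H1_cm_class \<Gamma> A G \<rho> \<theta> (u, \<psi>) \<in> i_star \<Gamma> A G \<rho> \<theta> ` H1 \<Gamma> G \<longleftrightarrow>
        G_orbit \<Gamma> A G \<theta> (Delta \<Gamma> A \<theta> (u, \<psi>)) \<in> neutral_elements \<Gamma> A G \<rho> \<theta>) \<and>
     (rho_star \<Gamma> A G \<rho> \<in> H1 \<Gamma> A \<rightarrow> H1 \<Gamma> G \<and>
      i_star \<Gamma> A G \<rho> \<theta> \<in> H1 \<Gamma> G \<rightarrow> H1_cm \<Gamma> A G \<rho> \<theta> \<and>
      Delta_rel \<Gamma> A G \<theta> \<in> H1_cm \<Gamma> A G \<rho> \<theta> \<rightarrow> H2_rel \<Gamma> A G \<rho> \<theta> \<and>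
      rho_star \<Gamma> A G \<rho> ` H1 \<Gamma> A =
        {x \<in> H1 \<Gamma> G. i_star \<Gamma> A G \<rho> \<theta> x = H1_cm_base \<Gamma> A G \<rho> \<theta>} \<and>
      i_star \<Gamma> A G \<rho> \<theta> ` H1 \<Gamma> G =
        {x \<in> H1_cm \<Gamma> A G \<rho> \<theta>. Delta_rel \<Gamma> A G \<theta> x \<in> neutral_elements \<Gamma> A G \<rho> \<theta>})"
proof -
  interpret profinite_crossed_module \<Gamma> A G \<rho> \<theta>
    using assms by (simp add: profinite_crossed_module_def)
  show ?thesis
    using i_star_image_iff_neutral rho_star_maps i_star_maps Delta_rel_maps exact_at_H1
      exact_at_H1_cm by blast
qed

end
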